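(* Let $G$ be an infinite discrete group and let $(X,G)$ be a minimal system. (1) If $(X,G)$ admits a $G$-invariant Borel probability measure, then $(X,G)$ is distal if and only if it is pairwise IP$^*$-equicontinuous. (2) If the product system $(X\times X,G)$ has a dense set of minimal points, then the following three conditions are equivalent: $(X,G)$ is distal; $(X,G)$ is pairwise IP$^*$-equicontinuous; $(X,G)$ is pairwise central$^*$-equicontinuous.
   Context: A (topological dynamical) system $(X,G)$ consists of a (nonempty) compact metric space $X$ with compatible metric $d$ and an infinite discrete group $G$ acting continuously on $X$. $G$ acts on $X\times X$ diagonally, $g(x,y)=(gx,gy)$. The orbit of $x$ is $Gx=\{gx: g\in G\}$. A system is minimal if it has no proper nonempty closed $G$-invariant subset; a point is minimal if it belongs to some minimal subsystem (nonempty closed $G$-invariant subset on which the action is minimal). A Borel probability measure $\mu$ is $G$-invariant if $\mu(gA)=\mu(A)$ for all $g\in G$ and Borel $A$. A pair $(x,y)$ is proximal if $\inf_{g\in G}d(gx,gy)=0$, and distal if $\inf_{g\in G}d(gx,gy)>0$. $(X,G)$ is distal if any two distinct points form a distal pair. For a sequence $\{p_i\}_{i=1}^\infty$ in $G$, $FP(\{p_i\}_{i=1}^\infty)=\{\prod_{i\in\alpha}p_i : \alpha\subset\mathbb{N}\text{ finite nonempty}\}$, products taken in increasing order of indices. $F\subset G$ is an IP-set if $FP(\{p_i\}_{i=1}^\infty)\subset F$ for some infinite sequence $\{p_i\}_{i=1}^\infty$ in $G$; an IP$^*$-set if it meets every IP-set in $G$. For a point $x$ and a set $U$ in a system, $N(x,U)=\{g\in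 G: gx\in U\}$. $F\subset G$ is a central set if there exist a system $(Z,G)$, points $x,y\in Z$ and a neighborhood $U$ of $y$ such that $(x,y)$ is a proximal pair, $y$ is a minimal point, and $F\supset N(x,U)$. $F\subset G$ is a central$^*$-set if it meets every central set in $G$. A point $x\in X$ is pairwise IP$^*$-equicontinuous (resp. pairwise central$^*$-equicontinuous) if for every $\varepsilon>0$ there is a neighborhood $U$ of $x$ such that for all $y,z\in U$ the set $\{g\in G: d(gy,gz)<\varepsilon\}$ is an IP$^*$-set (resp. a central$^*$-set). $(X,G)$ is pairwise IP$^*$-equicontinuous (resp. pairwise central$^*$-equicontinuous) if every point of $X$ is. *)

theory Defs
  imports "HOL-Probability.Probability_Measure" "HOL-Algebra.Group_Action"
begin

text \<open>
  The phase space is a compact subset \<open>X\<close> of a metric space type, carrying the metric of that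
  type. The action is a \<^locale>\<open>group_action\<close>, i.e. a homomorphism from \<open>G\<close> into the
  bijections of \<open>X\<close>. As \<open>G\<close> is discrete, continuity of the action means that every group element
  acts continuously.
\<close>

locale dyn_system = group_action G X \<phi>
  for G (structure) and X :: "'x::metric_space set" and \<phi> +
  assumes infinite_group: "infinite (carrier G)"
    and nonempty: "X \<noteq> {}"
    and compact: "compact X"
    and continuous: "\<And>g. g \<in> carrier G \<Longrightarrow> continuous_on X (\<phi> g)"

definition diag_action :: "'x set \<Rightarrow> ('g \<Rightarrow> 'x \<Rightarrow> 'x) \<Rightarrow> 'g \<Rightarrow> 'x \<times> 'x \<Rightarrow> 'x \<times> 'x"
  where "diag_action X \<phi> g = restrict (map_prod (\<phi> g) (\<phi> g)) (X \<times> X)"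

definition nbhd :: "'x::topological_space set \<Rightarrow> 'x \<Rightarrow> 'x set \<Rightarrow> bool"
  where "nbhd X x U \<longleftrightarrow> U \<subseteq> X \<and> (\<exists>V. openin (top_of_set X) V \<and> x \<in> V \<and> V \<subseteq> U)"


subsection \<open>Minimality and invariant measures\<close>

definition ginvariant :: "('g, 'm) monoid_scheme \<Rightarrow> ('g \<Rightarrow> 'x \<Rightarrow> 'x) \<Rightarrow> 'x set \<Rightarrow> bool"
  where "ginvariant G \<phi> Y \<longleftrightarrow> (\<forall>g \<in> carrier G. \<phi> g ` Y \<subseteq> Y)"

definition minimal_system ::
    "('g, 'm) monoid_scheme \<Rightarrow> 'x::topological_space set \<Rightarrow> ('g \<Rightarrow> 'x \<Rightarrow> 'x) \<Rightarrow> bool"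
  where "minimal_system G X \<phi> \<longleftrightarrow>
    \<not> (\<exists>Y. Y \<subset> X \<and> Y \<noteq> {} \<and> closedin (top_of_set X) Y \<and> ginvariant G \<phi> Y)"

definition minimal_point ::
    "('g, 'm) monoid_scheme \<Rightarrow> 'x::topological_space set \<Rightarrow> ('g \<Rightarrow> 'x \<Rightarrow> 'x) \<Rightarrow> 'x \<Rightarrow> bool"
  where "minimal_point G X \<phi> x \<longleftrightarrow>
    (\<exists>M. M \<noteq> {} \<and> closedin (top_of_set X) M \<and> ginvariant G \<phi> M \<and> minimal_system G M \<phi> \<and> x \<in> M)"

definition invariant_prob ::
    "('g, 'm) monoid_scheme \<Rightarrow> 'x::topological_space set \<Rightarrow> ('g \<Rightarrow> 'x \<Rightarrow> 'x) \<Rightarrow> 'x measure \<Rightarrow> bool"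
  where "invariant_prob G X \<phi> \<mu> \<longleftrightarrow>
    prob_space \<mu> \<and> sets \<mu> = sets (restrict_space borel X) \<and>
    (\<forall>g \<in> carrier G. \<forall>A \<in> sets \<mu>. emeasure \<mu> (\<phi> g ` A) = emeasure \<mu> A)"


subsection \<open>Proximality and distality\<close>

definition proximal_pair ::
    "('g, 'm) monoid_scheme \<Rightarrow> ('g \<Rightarrow> 'x::metric_space \<Rightarrow> 'x) \<Rightarrow> 'x \<Rightarrow> 'x \<Rightarrow> bool"
  where "proximal_pair G \<phi> x y \<longleftrightarrow> (INF g \<in> carrier G. dist (\<phi> g x) (\<phi> g y)) = 0"

definition distal_pair ::
    "('g, 'm) monoid_scheme \<Rightarrow> ('g \<Rightarrow> 'x::metric_space \<Rightarrow> 'x) \<Rightarrow> 'x \<Rightarrow> 'x \<Rightarrow> bool"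
  where "distal_pair G \<phi> x y \<longleftrightarrow> (INF g \<in> carrier G. dist (\<phi> g x) (\<phi> g y)) > 0"

definition distal_system ::
    "('g, 'm) monoid_scheme \<Rightarrow> 'x::metric_space set \<Rightarrow> ('g \<Rightarrow> 'x \<Rightarrow> 'x) \<Rightarrow> bool"
  where "distal_system G X \<phi> \<longleftrightarrow> (\<forall>x \<in> X. \<forall>y \<in> X. x \<noteq> y \<longrightarrow> distal_pair G \<phi> x y)"


subsection \<open>IP-sets and central sets\<close>

text \<open>
  \<open>p\<close> is any sequence in \<open>G\<close>; its terms need not be distinct. The product over \<open>\<alpha>\<close> is
  multiplied from left to right along increasing indices.
\<close>

definition FP :: "('g, 'm) monoid_scheme \<Rightarrow> (nat \<Rightarrow> 'g) \<Rightarrow> 'g set"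
  where "FP G p =
    {foldr (\<lambda>i a. p i \<otimes>\<^bsub>G\<^esub> a) (sorted_list_of_set \<alpha>) \<one>\<^bsub>G\<^esub> | \<alpha>. finite \<alpha> \<and> \<alpha> \<noteq> {}}"

definition IP_set :: "('g, 'm) monoid_scheme \<Rightarrow> 'g set \<Rightarrow> bool"
  where "IP_set G F \<longleftrightarrow> F \<subseteq> carrier G \<and> (\<exists>p. range p \<subseteq> carrier G \<and> FP G p \<subseteq> F)"

definition IP_star_set :: "('g, 'm) monoid_scheme \<Rightarrow> 'g set \<Rightarrow> bool"
  where "IP_star_set G F \<longleftrightarrow> F \<subseteq> carrier G \<and> (\<forall>E. IP_set G E \<longrightarrow> F \<inter> E \<noteq> {})"

definition hitting :: "('g, 'm) monoid_scheme \<Rightarrow> ('g \<Rightarrow> 'x \<Rightarrow> 'x) \<Rightarrow> 'x \<Rightarrow> 'x set \<Rightarrow> 'g set"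
  where "hitting G \<phi> x U = {g \<in> carrier G. \<phi> g x \<in> U}"

text \<open>
  HOL cannot quantify over types inside a definition. The witnessing system therefore ranges over
  compact subsets of the product \<open>nat \<Rightarrow> real\<close>, which contains a homeomorphic copy of every compact
  metric space. The lemma \<open>central_setI\<close> below shows that systems over arbitrary metric space
  types give the same central sets.
\<close>

definition central_set :: "('g, 'm) monoid_scheme \<Rightarrow> 'g set \<Rightarrow> bool"
  where "central_set G F \<longleftrightarrow> F \<subseteq> carrier G \<and>
    (\<exists>(Z :: (nat \<Rightarrow> real) set) \<psi> x y U.
       dyn_system G Z \<psi> \<and> x \<in> Z \<and> y \<in> Z \<and> nbhd Z y U \<and>
       proximal_pair G \<psi> x y \<and> minimal_point G Z \<psi> y \<and> hitting G \<psi> x U \<subseteq> F)"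

definition central_star_set :: "('g, 'm) monoid_scheme \<Rightarrow> 'g set \<Rightarrow> bool"
  where "central_star_set G F \<longleftrightarrow> F \<subseteq> carrier G \<and> (\<forall>E. central_set G E \<longrightarrow> F \<inter> E \<noteq> {})"


subsection \<open>Pairwise equicontinuity\<close>

definition pairwise_equicont_point ::
    "('g set \<Rightarrow> bool) \<Rightarrow> ('g, 'm) monoid_scheme \<Rightarrow> 'x::metric_space set \<Rightarrow> ('g \<Rightarrow> 'x \<Rightarrow> 'x) \<Rightarrow> 'x \<Rightarrow> bool"
  where "pairwise_equicont_point large G X \<phi> x \<longleftrightarrow>
    (\<forall>\<epsilon>>0. \<exists>U. nbhd X x U \<and>
       (\<forall>y \<in> U. \<forall>z \<in> U. large {g \<in> carrier G. dist (\<phi> g y) (\<phi> g z) < \<epsilon>}))"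

definition pairwise_IP_star_equicont ::
    "('g, 'm) monoid_scheme \<Rightarrow> 'x::metric_space set \<Rightarrow> ('g \<Rightarrow> 'x \<Rightarrow> 'x) \<Rightarrow> bool"
  where "pairwise_IP_star_equicont G X \<phi> \<longleftrightarrow>
    (\<forall>x \<in> X. pairwise_equicont_point (IP_star_set G) G X \<phi> x)"

definition pairwise_central_star_equicont ::
    "('g, 'm) monoid_scheme \<Rightarrow> 'x::metric_space set \<Rightarrow> ('g \<Rightarrow> 'x \<Rightarrow> 'x) \<Rightarrow> bool"
  where "pairwise_central_star_equicont G X \<phi> \<longleftrightarrow>
    (\<forall>x \<in> X. pairwise_equicont_point (central_star_set G) G X \<phi> x)"


subsection \<open>Product systems, and central sets from systems over any type\<close>

lemma group_actionI:
  assumes G: "group G"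
    and ext: "\<And>g. g \<in> carrier G \<Longrightarrow> \<phi> g \<in> extensional X"
    and maps: "\<And>g x. g \<in> carrier G \<Longrightarrow> x \<in> X \<Longrightarrow> \<phi> g x \<in> X"
    and one: "\<And>x. x \<in> X \<Longrightarrow> \<phi> \<one>\<^bsub>G\<^esub> x = x"
    and mult: "\<And>g h x. g \<in> carrier G \<Longrightarrow> h \<in> carrier G \<Longrightarrow> x \<in> X \<Longrightarrow>
      \<phi> (g \<otimes>\<^bsub>G\<^esub> h) x = \<phi> g (\<phi> h x)"
  shows "group_action G X \<phi>"
proof -
  interpret group G by fact
  have bij: "\<phi> g \<in> Bij X" if g: "g \<in> carrier G" for g
  proof -
    have "bij_betw (\<phi> g) X X"
      by (rule bij_betw_byWitness[where f' = "\<phi> (inv\<^bsub>G\<^esub> g)"])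
        (use g one mult maps in \<open>auto simp flip: mult\<close>)
    then show ?thesis using ext[OF g] by (simp add: Bij_def)
  qed
  show ?thesis
    unfolding group_action_def group_hom_def group_hom_axioms_def
  proof (intro conjI G group_BijGroup homI)
    fix g h assume gh: "g \<in> carrier G" "h \<in> carrier G"
    have "\<phi> (g \<otimes>\<^bsub>G\<^esub> h) = compose X (\<phi> g) (\<phi> h)"
      by (rule extensionalityI[where A = X]) (use gh ext mult in \<open>auto simp: compose_eq\<close>)
    then show "\<phi> (g \<otimes>\<^bsub>G\<^esub> h) = \<phi> g \<otimes>\<^bsub>BijGroup X\<^esub> \<phi> h"
      using gh bij by (simp add: BijGroup_def)
  qed (use bij in \<open>simp add: BijGroup_def\<close>)
qed

lemma (in group_action) is_group: "group G"
  using group_hom group_hom.axioms(1) by auto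

lemma (in group_action) act_one: "x \<in> E \<Longrightarrow> \<phi> \<one> x = x"
  using id_eq_one by (metis restrict_apply')

lemma (in group_action) act_closed: "g \<in> carrier G \<Longrightarrow> x \<in> E \<Longrightarrow> \<phi> g x \<in> E"
  using element_image by blast

lemma (in dyn_system) dyn_system_diag: "dyn_system G (X \<times> X) (diag_action X \<phi>)"
proof -
  have "group_action G (X \<times> X) (diag_action X \<phi>)"
    by (rule group_actionI)
      (auto simp: diag_action_def is_group act_one composition_rule act_closed)
  moreover have "continuous_on (X \<times> X) (diag_action X \<phi> g)" if g: "g \<in> carrier G" for g
  proof -
    have "continuous_on (X \<times> X) (\<lambda>p. (\<phi> g (fst p), \<phi> g (snd p)))"
      by (intro continuous_intros continuous_on_compose2[OF continuous[OF g]]) auto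
    then show ?thesis
      by (rule continuous_on_eq) (auto simp: diag_action_def)
  qed
  ultimately show ?thesis
    using infinite_group nonempty compact
    by (auto simp: dyn_system_def dyn_system_axioms_def compact_Times)
qed

lemma compact_embed_product:
  fixes Z :: "'z::metric_space set"
  assumes "compact Z" "Z \<noteq> {}"
  obtains e :: "'z \<Rightarrow> nat \<Rightarrow> real" and W f where "homeomorphism Z W e f"
proof -
  have "\<exists>k. finite k \<and> Z \<subseteq> (\<Union>x\<in>k. ball x \<epsilon>)" if "\<epsilon> > 0" for \<epsilon>
    using assms(1) that compact_eq_totally_bounded by blast
  then have "\<forall>n. \<exists>k. finite k \<and> Z \<subseteq> (\<Union>x\<in>k. ball x (1 / real (Suc n)))"
    by simp
  then obtain K where K: "\<And>n. finite (K n)" "\<And>n. Z \<subseteq> (\<Union>x\<in>K n. ball x (1 / real (Suc n)))"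
    by metis
  define D where "D = (\<Union>n. K n)"
  have "countable D" using K(1) by (auto simp: D_def intro: countable_finite)
  have "D \<noteq> {}" using K(2)[of 0] assms(2) by (auto simp: D_def)
  define q where "q = from_nat_into D"
  have range_q: "range q = D"
    unfolding q_def by (rule range_from_nat_into) fact+
  have near: "\<exists>n. dist z (q n) < \<epsilon>" if z: "z \<in> Z" and \<epsilon>: "\<epsilon> > 0" for z \<epsilon>
  proof -
    obtain m where m: "1 / real (Suc m) < \<epsilon>" using nat_approx_posE[OF \<epsilon>] by blast
    obtain x where x: "x \<in> K m" "dist x z < 1 / real (Suc m)"
      using K(2)[of m] z by auto
    then have "x \<in> range q" unfolding range_q D_def by blast
    then obtain n where "q n = x" by blast
    then show ?thesis using x m by (intro exI[of _ n]) (simp add: dist_commute)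
  qed
  define e where "e = (\<lambda>z n. dist z (q n))"
  have "continuous_on Z e"
    unfolding e_def by (intro continuous_on_coordinatewise_then_product continuous_intros)
  moreover have "inj_on e Z"
  proof (rule inj_onI, rule ccontr)
    fix x y assume xy: "x \<in> Z" "y \<in> Z" "e x = e y" "x \<noteq> y"
    then obtain n where n: "dist x (q n) < dist x y / 2"
      using near[of x "dist x y / 2"] by auto
    moreover have "dist y (q n) = dist x (q n)"
      using fun_cong[OF xy(3), of n] by (simp add: e_def)
    ultimately show False
      using dist_triangle2[of x y "q n"] by linarith
  qed
  ultimately obtain f where "homeomorphism Z (e ` Z) e f"
    using homeomorphism_compact[OF assms(1)] by blast
  then show thesis by (rule that)
qed

lemma proximal_pair_iff:
  assumes "group G"
  shows "proximal_pair G \<phi> x y \<longleftrightarrow> (\<forall>\<epsilon>>0. \<exists>g\<in>carrier G. dist (\<phi> g x) (\<phi> g y) < \<epsilon>)"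
proof -
  interpret group G by fact
  let ?D = "(\<lambda>g. dist (\<phi> g x) (\<phi> g y)) ` carrier G"
  have ne: "?D \<noteq> {}" by auto
  have bdd: "bdd_below ?D" by (rule bdd_belowI[of _ 0]) auto
  have nn: "Inf ?D \<ge> 0" by (rule cInf_greatest[OF ne]) auto
  have "(\<forall>\<epsilon>>0. \<exists>g\<in>carrier G. dist (\<phi> g x) (\<phi> g y) < \<epsilon>) \<longleftrightarrow> (\<forall>\<epsilon>>0. Inf ?D < \<epsilon>)"
    using cInf_less_iff[OF ne bdd] by auto
  also have "\<dots> \<longleftrightarrow> Inf ?D = 0"
    using nn by (metis less_irrefl order_le_less)
  finally show ?thesis by (simp add: proximal_pair_def)
qed

lemma central_setI:
  fixes Z :: "'z::metric_space set"
  assumes sys: "dyn_system G Z \<psi>" and x: "x \<in> Z" and y: "y \<in> Z" and U: "nbhd Z y U"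
    and prox: "proximal_pair G \<psi> x y" and min: "minimal_point G Z \<psi> y"
    and F: "hitting G \<psi> x U \<subseteq> F" "F \<subseteq> carrier G"
  shows "central_set G F"
proof -
  interpret dyn_system G Z \<psi> by fact
  obtain e :: "'z \<Rightarrow> nat \<Rightarrow> real" and W f where h: "homeomorphism Z W e f"
    using compact_embed_product[OF compact nonempty] by blast
  note hd = h[unfolded homeomorphism_def]
  have eW: "\<And>z. z \<in> Z \<Longrightarrow> e z \<in> W" and fZ: "\<And>w. w \<in> W \<Longrightarrow> f w \<in> Z"
    and fe: "\<And>z. z \<in> Z \<Longrightarrow> f (e z) = z" and ef: "\<And>w. w \<in> W \<Longrightarrow> e (f w) = w"
    and ce: "continuous_on Z e" and cf: "continuous_on W f" using hd by auto
  define \<theta> where "\<theta> g = restrict (\<lambda>w. e (\<psi> g (f w))) W" for g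
  have \<theta>e: "\<theta> g (e z) = e (\<psi> g z)" if "z \<in> Z" for g z
    using that by (simp add: \<theta>_def eW fe)
  have "compact W" using compact_continuous_image[OF ce compact] hd by simp
  have "group_action G W \<theta>"
    by (rule group_actionI)
      (auto simp: \<theta>_def is_group act_one composition_rule act_closed fZ eW fe ef)
  moreover have "continuous_on W (\<theta> g)" if g: "g \<in> carrier G" for g
  proof -
    have "continuous_on W (\<lambda>w. e (\<psi> g (f w)))"
      by (intro continuous_on_compose2[OF ce] continuous_on_compose2[OF continuous[OF g]] cf)
        (auto simp: fZ act_closed g)
    then show ?thesis by (rule continuous_on_eq) (simp add: \<theta>_def)
  qed
  ultimately have sysW: "dyn_system G W \<theta>"
    using infinite_group \<open>compact W\<close> eW[OF x]
    by (auto simp: dyn_system_def dyn_system_axioms_def)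
  have proxW: "proximal_pair G \<theta> (e x) (e y)"
    unfolding proximal_pair_iff[OF is_group]
  proof (intro allI impI)
    fix \<epsilon> :: real assume "\<epsilon> > 0"
    then obtain d where d: "d > 0" "\<And>u v. u \<in> Z \<Longrightarrow> v \<in> Z \<Longrightarrow> dist u v < d \<Longrightarrow> dist (e u) (e v) < \<epsilon>"
      using compact_uniformly_continuous[OF ce compact] unfolding uniformly_continuous_on_def
      by metis
    then obtain g where "g \<in> carrier G" "dist (\<psi> g x) (\<psi> g y) < d"
      using prox unfolding proximal_pair_iff[OF is_group] by blast
    then show "\<exists>g\<in>carrier G. dist (\<theta> g (e x)) (\<theta> g (e y)) < \<epsilon>"
      by (intro bexI[of _ g]) (simp_all add: \<theta>e x y d(2) act_closed)
  qed
  obtain M where M: "M \<noteq> {}" "closedin (top_of_set Z) M" "ginvariant G \<psi> M"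
      "minimal_system G M \<psi>" "y \<in> M"
    using min unfolding minimal_point_def by blast
  have MZ: "M \<subseteq> Z" using M(2) closedin_subset by fastforce
  have cM: "compact M" using closedin_compact[OF compact M(2)] .
  have cl_eM: "closed (e ` M)"
    by (intro compact_imp_closed compact_continuous_image cM continuous_on_subset[OF ce MZ])
  have eMW: "e ` M \<subseteq> W" using MZ eW by auto
  have "minimal_system G (e ` M) \<theta>"
    unfolding minimal_system_def
  proof (rule notI, elim exE conjE)
    fix Y assume Y: "Y \<subset> e ` M" "Y \<noteq> {}" "closedin (top_of_set (e ` M)) Y" "ginvariant G \<theta> Y"
    have YW: "Y \<subseteq> W" using Y(1) eMW by blast
    have "compact (e ` M)"
      by (intro compact_continuous_image cM continuous_on_subset[OF ce MZ])
    then have "compact Y" using closedin_compact Y(3) by blast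
    then have "closed (f ` Y)"
      by (intro compact_imp_closed compact_continuous_image continuous_on_subset[OF cf YW])
    moreover have fYM: "f ` Y \<subseteq> M"
    proof -
      have "f ` e ` M = M" using MZ fe by (force simp: image_image)
      then show ?thesis using Y(1) by blast
    qed
    ultimately have "closedin (top_of_set M) (f ` Y)" by (simp add: closed_subset)
    moreover have "f ` Y \<noteq> M"
    proof
      assume "f ` Y = M"
      moreover have "e ` f ` Y = Y" using YW ef by (force simp: image_image)
      ultimately show False using Y(1) by blast
    qed
    moreover have "ginvariant G \<psi> (f ` Y)"
      unfolding ginvariant_def
    proof (intro ballI subsetI)
      fix g z assume g: "g \<in> carrier G" and "z \<in> \<psi> g ` f ` Y"
      then obtain w where w: "w \<in> Y" "z = \<psi> g (f w)" by blast
      have "\<theta> g w \<in> Y" using Y(4) g w(1) by (auto simp: ginvariant_def)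
      moreover have "f (\<theta> g w) = z" using w YW g by (auto simp: \<theta>_def fe act_closed fZ)
      ultimately show "z \<in> f ` Y" by blast
    qed
    ultimately show False using M(4) fYM Y(2) unfolding minimal_system_def by blast
  qed
  moreover have "ginvariant G \<theta> (e ` M)"
    unfolding ginvariant_def
  proof (intro ballI subsetI)
    fix g w assume g: "g \<in> carrier G" and "w \<in> \<theta> g ` e ` M"
    then obtain z where z: "z \<in> M" "w = \<theta> g (e z)" by blast
    have "\<psi> g z \<in> M" using M(3) g z(1) by (auto simp: ginvariant_def)
    moreover have "w = e (\<psi> g z)" using z MZ by (auto simp: \<theta>e)
    ultimately show "w \<in> e ` M" by blast
  qed
  moreover have "closedin (top_of_set W) (e ` M)"
    by (rule closed_subset[OF eMW cl_eM])
  ultimately have minW: "minimal_point G W \<theta> (e y)"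
    using M(1,5) unfolding minimal_point_def by (intro exI[of _ "e ` M"]) simp
  obtain V where V: "U \<subseteq> Z" "openin (top_of_set Z) V" "y \<in> V" "V \<subseteq> U"
    using U unfolding nbhd_def by blast
  have "openin (top_of_set W) (e ` V)"
    using homeomorphism_imp_open_map[OF h V(2)] .
  then have nW: "nbhd W (e y) (e ` U)"
    using V eW unfolding nbhd_def by (intro conjI exI[of _ "e ` V"]) auto
  have "hitting G \<theta> (e x) (e ` U) \<subseteq> hitting G \<psi> x U"
  proof
    fix g assume "g \<in> hitting G \<theta> (e x) (e ` U)"
    then obtain u where g: "g \<in> carrier G" and u: "u \<in> U" "e (\<psi> g x) = e u"
      by (auto simp: hitting_def \<theta>e x)
    have "\<psi> g x = f (e (\<psi> g x))" using fe[OF act_closed[OF g x]] by (rule sym)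
    also have "\<dots> = f (e u)" by (rule arg_cong[OF u(2)])
    also have "\<dots> = u" by (rule fe[OF subsetD[OF V(1) u(1)]])
    finally have "\<psi> g x = u" .
    then show "g \<in> hitting G \<psi> x U" using g u by (simp add: hitting_def)
  qed
  then have "hitting G \<theta> (e x) (e ` U) \<subseteq> F" using F(1) by (rule subset_trans)
  then have "dyn_system G W \<theta> \<and> e x \<in> W \<and> e y \<in> W \<and> nbhd W (e y) (e ` U) \<and>
      proximal_pair G \<theta> (e x) (e y) \<and> minimal_point G W \<theta> (e y) \<and>
      hitting G \<theta> (e x) (e ` U) \<subseteq> F"
    by (intro conjI sysW proxW minW nW eW x y)
  then show ?thesis
    unfolding central_set_def by (intro conjI[OF F(2)] exI)
qed

end

theory Submission
  imports Defs
begin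

text \<open>
  Everything is read off from the idempotents \<open>u\<close> of the closure of the action in \<open>X\<^sup>X\<close>. They satisfy
  that \<open>x\<close> and \<open>u x\<close> are proximal, the set of return times of \<open>x\<close> to a neighbourhood of \<open>u x\<close> is an
  IP-set, and every IP-set has one in its closure. In a distal system they are therefore the
  identity, which gives IP*-equicontinuity. A proximal pair \<open>(x, y)\<close> with \<open>y\<close> minimal satisfies
  \<open>u x = y\<close> for some \<open>u\<close>, so central sets are IP-sets and IP*-equicontinuity implies
  central*-equicontinuity.

  Conversely, equicontinuity turns (minimal) idempotents into continuous maps. If minimal points are
  dense in \<open>X \<times> X\<close>, a minimal pair near a proximal pair \<open>(x, y)\<close> would be moved close together by an
  idempotent \<open>u\<close> with \<open>u x = u y\<close> and then, by a second return, be close itself. If there is an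
  invariant measure, Poincare recurrence along an IP-set of times at which \<open>x\<close> is near \<open>u x = y\<close>
  produces a point near \<open>x\<close> that stays near \<open>x\<close> along a sub-IP-set, against equicontinuity at \<open>x\<close>.
\<close>

subsection \<open>Idempotents in compact right topological semigroups\<close>

text \<open>Zorn's lemma for reverse inclusion: a chain of nonempty compact sets has nonempty
  intersection. \<open>P\<close> is kept abstract because it serves for subsemigroups and for left
  ideals.\<close>

lemma exists_minimal_compact:
  fixes T0 :: "'a::t2_space set"
  assumes T0: "compact T0" "T0 \<noteq> {}" "P T0"
    and Inter: "\<And>C. C \<noteq> {} \<Longrightarrow> (\<And>T. T \<in> C \<Longrightarrow> P T) \<Longrightarrow> P (\<Inter>C)"
  obtains T where "T \<subseteq> T0" "compact T" "T \<noteq> {}" "P T"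
    "\<And>S. S \<subseteq> T \<Longrightarrow> compact S \<Longrightarrow> S \<noteq> {} \<Longrightarrow> P S \<Longrightarrow> S = T"
proof -
  define A where "A = {T. T \<subseteq> T0 \<and> compact T \<and> T \<noteq> {} \<and> P T}"
  have "\<exists>T\<in>A. \<forall>S\<in>A. T \<supseteq> S \<longrightarrow> S = T"
  proof (rule predicate_Zorn)
    show "partial_order_on A (relation_of (\<supseteq>) A)"
      by (rule partial_order_on_relation_ofI) auto
    fix C assume "C \<in> Chains (relation_of (\<supseteq>) A)"
    then have CA: "C \<subseteq> A" and chain: "\<And>S T. S \<in> C \<Longrightarrow> T \<in> C \<Longrightarrow> S \<subseteq> T \<or> T \<subseteq> S"
      by (auto simp: Chains_def relation_of_def)
    show "\<exists>u\<in>A. \<forall>a\<in>C. a \<supseteq> u"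
    proof (cases "C = {}")
      case True
      then show ?thesis using T0 by (auto simp: A_def)
    next
      case False
      have cl: "closed T" if "T \<in> C" for T
        using that CA compact_imp_closed by (auto simp: A_def)
      \<comment> \<open>A finite intersection of members of a chain is again a member, so the finite
        intersection property applies.\<close>
      have least: "\<exists>T\<in>C. T0 \<inter> \<Inter>F = T0 \<inter> T" if "finite F" "F \<noteq> {}" "F \<subseteq> C" for F
        using that
      proof (induction F rule: finite_ne_induct)
        case (insert S F)
        then obtain T where "T \<in> C" "T0 \<inter> \<Inter>F = T0 \<inter> T" by auto
        then show ?case using chain[of S T] insert.prems by (intro bexI[of _ "S \<inter> T"])
          (auto simp: Int_absorb1 Int_absorb2)
      qed auto
      have "T0 \<inter> \<Inter>C \<noteq> {}"
      proof (rule compact_imp_fip[OF T0(1) cl])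
        fix F assume F: "finite F" "F \<subseteq> C"
        show "T0 \<inter> \<Inter>F \<noteq> {}"
        proof (cases "F = {}")
          case False
          then obtain T where "T \<in> C" "T0 \<inter> \<Inter>F = T0 \<inter> T" using least[OF F(1) False F(2)] by auto
          then show ?thesis using CA by (auto simp: A_def)
        qed (use T0 in simp)
      qed
      moreover have "\<Inter>C \<subseteq> T0" using False CA by (auto simp: A_def)
      moreover have "closed (\<Inter>C)" using cl by blast
      moreover have "P (\<Inter>C)" using Inter[OF False] CA by (auto simp: A_def)
      ultimately have "\<Inter>C \<in> A"
        using compact_Int_closed[OF T0(1), of "\<Inter>C"] by (simp add: A_def Int_absorb1)
      then show ?thesis by blast
    qed
  qed
  then obtain T where "T \<in> A" "\<And>S. S \<in> A \<Longrightarrow> S \<subseteq> T \<Longrightarrow> S = T" by blast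
  then show thesis by (intro that[of T]) (auto simp: A_def)
qed

text \<open>For \<open>u\<close> in a minimal compact subsemigroup \<open>T\<close>, the set
  \<open>T u\<close> is a compact subsemigroup, so it is all of \<open>T\<close> and contains
  \<open>u\<close>. Then the \<open>p\<close> in \<open>T\<close> with \<open>p u = u\<close> form
  another compact subsemigroup, which is again \<open>T\<close> and hence contains \<open>u\<close>.
  Continuity in the left factor makes both sets compact.\<close>

lemma Ellis_Numakura:
  fixes S :: "'a::t2_space set"
  assumes S: "compact S" "S \<noteq> {}"
    and cont: "\<And>q. q \<in> S \<Longrightarrow> continuous_on S (\<lambda>p. f p q)"
    and closed: "\<And>p q. p \<in> S \<Longrightarrow> q \<in> S \<Longrightarrow> f p q \<in> S"
    and assoc: "\<And>p q r. p \<in> S \<Longrightarrow> q \<in> S \<Longrightarrow> r \<in> S \<Longrightarrow> f (f p q) r = f p (f q r)"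
  obtains u where "u \<in> S" "f u u = u"
proof -
  obtain T where T: "T \<subseteq> S" "compact T" "T \<noteq> {}" "\<And>p q. p \<in> T \<Longrightarrow> q \<in> T \<Longrightarrow> f p q \<in> T"
    and min: "\<And>R. R \<subseteq> T \<Longrightarrow> compact R \<Longrightarrow> R \<noteq> {} \<Longrightarrow> \<forall>p\<in>R. \<forall>q\<in>R. f p q \<in> R \<Longrightarrow> R = T"
    by (rule exists_minimal_compact[of S "\<lambda>R. \<forall>p\<in>R. \<forall>q\<in>R. f p q \<in> R"]) (use S closed in auto)
  obtain u where u: "u \<in> T" using T(3) by blast
  have contT: "continuous_on T (\<lambda>p. f p u)"
    using cont u T(1) continuous_on_subset by blast
  have "(\<lambda>p. f p u) ` T = T"
  proof (rule min)
    show "compact ((\<lambda>p. f p u) ` T)" by (rule compact_continuous_image[OF contT T(2)])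
    show "\<forall>p\<in>(\<lambda>p. f p u) ` T. \<forall>q\<in>(\<lambda>p. f p u) ` T. f p q \<in> (\<lambda>p. f p u) ` T"
    proof (clarify)
      fix p q assume pq: "p \<in> T" "q \<in> T"
      have "f p u \<in> S" "q \<in> S" "u \<in> S" using pq u T(1,4) by auto
      then have "f (f p u) (f q u) = f (f (f p u) q) u"
        by (rule assoc[symmetric])
      then show "f (f p u) (f q u) \<in> (\<lambda>p. f p u) ` T" using pq u T(4) by auto
    qed
  qed (use T u in auto)
  then obtain v where "v \<in> T" "f v u = u" using u by (metis imageE)
  then have ne: "T \<inter> (\<lambda>p. f p u) -` {u} \<noteq> {}" by auto
  have "T \<inter> (\<lambda>p. f p u) -` {u} = T"
  proof (rule min)
    have "closed (T \<inter> (\<lambda>p. f p u) -` {u})"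
      by (intro continuous_closed_preimage contT compact_imp_closed T) auto
    then show "compact (T \<inter> (\<lambda>p. f p u) -` {u})"
      using compact_Int_closed[OF T(2)] by (metis inf.left_idem)
    show "\<forall>p\<in>T \<inter> (\<lambda>p. f p u) -` {u}. \<forall>q\<in>T \<inter> (\<lambda>p. f p u) -` {u}. f p q \<in> T \<inter> (\<lambda>p. f p u) -` {u}"
    proof (intro ballI)
      fix p q assume pq: "p \<in> T \<inter> (\<lambda>p. f p u) -` {u}" "q \<in> T \<inter> (\<lambda>p. f p u) -` {u}"
      then have "f (f p q) u = f p (f q u)"
        using T(1) u by (intro assoc) auto
      then show "f p q \<in> T \<inter> (\<lambda>p. f p u) -` {u}" using pq T(4) by simp
    qed
  qed (use ne in auto)
  then have "f u u = u" using u by blast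
  then show thesis using that u T(1) by blast
qed

section \<open>Hausdorff and compact function spaces\<close>

lemma open_vimage_coordinate:
  "open U \<Longrightarrow> open ((\<lambda>h::'a \<Rightarrow> 'b::topological_space. h x) -` U)"
  by (rule open_vimage[OF _ continuous_on_product_coordinates])

instance "fun" :: (type, t0_space) t0_space
proof
  fix f g :: "'a \<Rightarrow> 'b" assume "f \<noteq> g"
  then obtain x where ne: "f x \<noteq> g x" by (meson ext)
  then obtain U where "open U" "\<not> (f x \<in> U \<longleftrightarrow> g x \<in> U)"
    using t0_space_class.t0_space[OF ne] by blast
  then show "\<exists>U. open U \<and> \<not> (f \<in> U \<longleftrightarrow> g \<in> U)"
    by (intro exI[of _ "(\<lambda>h. h x) -` U"] conjI open_vimage_coordinate) simp_all
qed

instance "fun" :: (type, t1_space) t1_space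
proof
  fix f g :: "'a \<Rightarrow> 'b" assume "f \<noteq> g"
  then obtain x where ne: "f x \<noteq> g x" by (meson ext)
  then obtain U where "open U" "f x \<in> U" "g x \<notin> U"
    using t1_space_class.t1_space[OF ne] by blast
  then show "\<exists>U. open U \<and> f \<in> U \<and> g \<notin> U"
    by (intro exI[of _ "(\<lambda>h. h x) -` U"] conjI open_vimage_coordinate) simp_all
qed

instance "fun" :: (type, t2_space) t2_space
proof
  fix f g :: "'a \<Rightarrow> 'b" assume "f \<noteq> g"
  then obtain x where ne: "f x \<noteq> g x" by (meson ext)
  then obtain U V where "open U" "open V" "f x \<in> U" "g x \<in> V" "U \<inter> V = {}"
    using hausdorff[OF ne] by blast
  then show "\<exists>U V. open U \<and> open V \<and> f \<in> U \<and> g \<in> V \<and> U \<inter> V = {}"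
    by (intro exI[of _ "(\<lambda>h. h x) -` U"] exI[of _ "(\<lambda>h. h x) -` V"] conjI
        open_vimage_coordinate) (simp_all flip: vimage_Int)
qed

lemma compact_PiE:
  fixes X :: "'a \<Rightarrow> 'b::topological_space set"
  assumes "\<And>i. i \<in> I \<Longrightarrow> compact (X i)"
  shows "compact (PiE I X)"
proof -
  \<comment> \<open>Members of \<open>PiE I X\<close> take the value \<open>undefined\<close> off
    \<open>I\<close>. A singleton factor there turns the set into a full product over
    \<open>UNIV\<close>, to which Tychonoff's theorem applies.\<close>
  define Y where "Y i = (if i \<in> I then X i else {undefined})" for i
  have "f \<in> PiE I X \<longleftrightarrow> f \<in> PiE UNIV Y" for f
  proof -
    have "f \<in> PiE I X \<longleftrightarrow> (\<forall>i. f i \<in> Y i)"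
      by (simp add: PiE_iff extensional_def Y_def) blast
    then show ?thesis by (simp add: PiE_iff)
  qed
  then have eq: "PiE I X = PiE UNIV Y" by blast
  have "compact (Y i)" for i using assms by (simp add: Y_def)
  then have "compactin (product_topology (\<lambda>i. euclidean) UNIV) (PiE UNIV Y)"
    by (subst compactin_PiE) simp
  then show ?thesis
    unfolding eq euclidean_product_topology by simp
qed


subsection \<open>Finite products of tails of a sequence\<close>

text \<open>Products over increasing indices that are all at least \<open>n\<close>, built by
  peeling off the first factor. Sorted lists give way to an induction in which the next admissible
  index is explicit.\<close>

inductive tail_product :: "('g, 'm) monoid_scheme \<Rightarrow> (nat \<Rightarrow> 'g) \<Rightarrow> nat \<Rightarrow> 'g \<Rightarrow> bool"
  for G p where
  single: "n \<le> k \<Longrightarrow> tail_product G p n (p k)"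
| cons: "n \<le> k \<Longrightarrow> tail_product G p (Suc k) h \<Longrightarrow> tail_product G p n (p k \<otimes>\<^bsub>G\<^esub> h)"

definition FP_from :: "('g, 'm) monoid_scheme \<Rightarrow> (nat \<Rightarrow> 'g) \<Rightarrow> nat \<Rightarrow> 'g set"
  where "FP_from G p n = {h. tail_product G p n h}"

lemma FP_from_single: "n \<le> k \<Longrightarrow> p k \<in> FP_from G p n"
  by (simp add: FP_from_def tail_product.single)

lemma FP_from_cons: "n \<le> k \<Longrightarrow> h \<in> FP_from G p (Suc k) \<Longrightarrow> p k \<otimes>\<^bsub>G\<^esub> h \<in> FP_from G p n"
  by (simp add: FP_from_def tail_product.cons)

lemma FP_from_induct [consumes 1, case_names single cons]:
  assumes "h \<in> FP_from G p n"
    and "\<And>n k. n \<le> k \<Longrightarrow> P n (p k)"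
    and "\<And>n k h. n \<le> k \<Longrightarrow> h \<in> FP_from G p (Suc k) \<Longrightarrow> P (Suc k) h \<Longrightarrow> P n (p k \<otimes>\<^bsub>G\<^esub> h)"
  shows "P n h"
proof -
  have "tail_product G p n h" using assms(1) by (simp add: FP_from_def)
  then show ?thesis
    by (induction rule: tail_product.induct) (use assms(2,3) in \<open>simp_all add: FP_from_def\<close>)
qed

lemma FP_from_antimono:  "h \<in> FP_from G p n \<Longrightarrow> m \<le> n \<Longrightarrow> h \<in> FP_from G p m"
proof (induction arbitrary: m rule: FP_from_induct)
  case (single n k)
  then show ?case by (intro FP_from_single[of m k p]) simp
next
  case (cons n k h)
  then show ?case by (intro FP_from_cons[of m k h G p]) simp_all
qed

context group
begin

lemma FP_from_closed:
  assumes p: "range p \<subseteq> carrier G" and h: "h \<in> FP_from G p n"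
  shows "h \<in> carrier G"
  using h by (induction rule: FP_from_induct) (use range_subsetD[OF p] in auto)

text \<open>For \<open>m\<close> take one more than the last index used in \<open>h\<close>:
  products of later terms may then be appended. This is what makes the limits along all tails closed
  under composition.\<close>

lemma FP_from_mult:
  assumes p: "range p \<subseteq> carrier G" and h: "h \<in> FP_from G p n"
  shows "\<exists>m\<ge>n. \<forall>k\<in>FP_from G p m. h \<otimes> k \<in> FP_from G p n"
  using h
proof (induction rule: FP_from_induct)
  case (single n k)
  then show ?case
    by (intro exI[of _ "Suc k"]) (simp add: FP_from_cons)
next
  case (cons n k h)
  then obtain m where m: "m \<ge> Suc k" "\<And>l. l \<in> FP_from G p m \<Longrightarrow> h \<otimes> l \<in> FP_from G p (Suc k)"
    by auto
  have "p k \<otimes> h \<otimes> l \<in> FP_from G p n" if l: "l \<in> FP_from G p m" for l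
  proof -
    have "p k \<otimes> h \<otimes> l = p k \<otimes> (h \<otimes> l)"
      by (rule m_assoc[OF range_subsetD[OF p] FP_from_closed[OF p cons.hyps(2)] FP_from_closed[OF p l]])
    then show ?thesis using FP_from_cons[OF cons.hyps(1) m(2)[OF l]] by simp
  qed
  then show ?case using m(1) cons.hyps(1) by (intro exI[of _ m]) auto
qed

lemma FP_from_foldr:
  assumes p: "range p \<subseteq> carrier G"
  shows "xs \<noteq> [] \<Longrightarrow> sorted_wrt (<) xs \<Longrightarrow> \<forall>k\<in>set xs. n \<le> k \<Longrightarrow>
    foldr (\<lambda>i a. p i \<otimes> a) xs \<one> \<in> FP_from G p n"
proof (induction xs arbitrary: n)
  case (Cons k xs)
  show ?case
  proof (cases "xs = []")
    case True
    then show ?thesis using Cons.prems range_subsetD[OF p, of k] by (simp add: FP_from_single)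
  next
    case False
    then show ?thesis using Cons.prems by (simp add: FP_from_cons Cons.IH Suc_le_eq)
  qed
qed simp

lemma FP_eq_FP_from:
  assumes p: "range p \<subseteq> carrier G"
  shows "FP G p = FP_from G p 0"
proof (intro equalityI subsetI)
  fix h assume "h \<in> FP G p"
  then obtain \<alpha> where \<alpha>: "finite \<alpha>" "\<alpha> \<noteq> {}" and h: "h = foldr (\<lambda>i a. p i \<otimes> a) (sorted_list_of_set \<alpha>) \<one>"
    by (auto simp: FP_def)
  show "h \<in> FP_from G p 0" unfolding h by (rule FP_from_foldr[OF p]) (use \<alpha> in auto)
next
  have "\<exists>\<alpha>. finite \<alpha> \<and> \<alpha> \<noteq> {} \<and> \<alpha> \<subseteq> {n..} \<and> h = foldr (\<lambda>i a. p i \<otimes> a) (sorted_list_of_set \<alpha>) \<one>"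
    if "h \<in> FP_from G p n" for h n
    using that
  proof (induction rule: FP_from_induct)
    case (single n k)
    then show ?case using range_subsetD[OF p, of k] by (intro exI[of _ "{k}"]) auto
  next
    case (cons n k h)
    then obtain \<alpha> where \<alpha>: "finite \<alpha>" "\<alpha> \<noteq> {}" "\<alpha> \<subseteq> {Suc k..}"
      "h = foldr (\<lambda>i a. p i \<otimes> a) (sorted_list_of_set \<alpha>) \<one>" by auto
    \<comment> \<open>\<open>k\<close> lies below all of \<open>\<alpha>\<close>, so adjoining it
      puts it at the head of the sorted list.\<close>
    have "k \<notin> \<alpha>" using \<alpha>(3) by auto
    moreover have "insort k (sorted_list_of_set \<alpha>) = k # sorted_list_of_set \<alpha>"
      by (rule insort_is_Cons) (use \<alpha> in auto)
    ultimately have "sorted_list_of_set (insert k \<alpha>) = k # sorted_list_of_set \<alpha>"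
      using \<alpha>(1) by simp
    then show ?case using \<alpha> cons.hyps(1) by (intro exI[of _ "insert k \<alpha>"]) auto
  qed
  then show "h \<in> FP G p" if "h \<in> FP_from G p 0" for h
    using that by (fastforce simp: FP_def)
qed

text \<open>The \<open>g k\<close> are products over successive blocks of indices: block
  \<open>k\<close> begins at \<open>m k\<close> or later and may be followed by anything from
  \<open>m (Suc k)\<close> on. This yields an IP-set inside a given one.\<close>

lemma FP_from_blocks:
  assumes "\<And>k. g k \<in> FP_from G p (m k)" "\<And>k. m k \<le> m (Suc k)"
    and "\<And>k h. h \<in> FP_from G p (m (Suc k)) \<Longrightarrow> g k \<otimes> h \<in> FP_from G p (m k)"
    and h: "h \<in> FP_from G g n"
  shows "h \<in> FP_from G p (m n)"
proof -
  have mono: "n \<le> k \<Longrightarrow> m n \<le> m k" for n k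
    by (rule lift_Suc_mono_le[of m]) (use assms in auto)
  show ?thesis using h
  proof (induction rule: FP_from_induct)
    case (single n k)
    then show ?case by (rule FP_from_antimono[OF assms(1) mono])
  next
    case (cons n k h)
    then show ?case by (intro FP_from_antimono[OF assms(3) mono])
  qed
qed

lemma IP_setI:
  assumes "range p \<subseteq> carrier G" "FP_from G p 0 \<subseteq> F" "F \<subseteq> carrier G"
  shows "IP_set G F"
  using assms FP_eq_FP_from unfolding IP_set_def by blast

lemma IP_setE:
  assumes "IP_set G F"
  obtains p where "range p \<subseteq> carrier G" "FP_from G p 0 \<subseteq> F"
  using assms FP_eq_FP_from unfolding IP_set_def by blast

text \<open>Here \<open>h 0\<close> is \<open>\<one>\<close> and \<open>h k\<close> is the product
  of \<open>p n\<close> up to \<open>p (n + k - 1)\<close>. The quotient of two such partial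
  products is the product of the terms in between, hence itself a finite product of
  \<open>p\<close>.\<close>

lemma FP_from_partial_products:
  fixes n i d :: nat and p :: "nat \<Rightarrow> 'a"
  assumes p: "range p \<subseteq> carrier G"
  defines "h \<equiv> rec_nat \<one> (\<lambda>k a. a \<otimes> p (n + k))"
  shows "\<exists>g\<in>FP_from G p (n + i). h (i + Suc d) = h i \<otimes> g"
proof (induction d arbitrary: i)
  case 0
  show ?case by (intro bexI[of _ "p (n + i)"]) (simp_all add: h_def FP_from_single)
next
  case (Suc d)
  have hc: "h k \<in> carrier G" for k
    by (induction k) (use p in \<open>auto simp: h_def\<close>)
  obtain g where g: "g \<in> FP_from G p (n + Suc i)" "h (Suc i + Suc d) = h (Suc i) \<otimes> g"
    using Suc by blast
  have "h (Suc i) = h i \<otimes> p (n + i)" by (simp add: h_def)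
  moreover have "g \<in> carrier G" using FP_from_closed[OF p g(1)] .
  ultimately have "h (i + Suc (Suc d)) = h i \<otimes> (p (n + i) \<otimes> g)"
    using g(2) p hc[of i] m_assoc[of "h i" "p (n + i)" g] by auto
  moreover have "p (n + i) \<otimes> g \<in> FP_from G p (n + i)"
    using g(1) by (simp add: FP_from_cons)
  ultimately show ?case by blast
qed

end

subsection \<open>The enveloping semigroup\<close>

sublocale dyn_system \<subseteq> group G
  by (rule is_group)

context dyn_system
begin

text \<open>The Ellis semigroup, with the closure taken for pointwise convergence in the whole
  function type. The maps \<open>\<phi> g\<close> are extensional, so the closure stays inside the
  compact set \<open>PiE X (\<lambda>_. X)\<close>.\<close>

definition ellis :: "('x \<Rightarrow> 'x) set"
  where "ellis = closure (\<phi> ` carrier G)"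

lemma closure_act_subset:
  assumes "H \<subseteq> carrier G"
  shows "closure (\<phi> ` H) \<subseteq> PiE X (\<lambda>_. X)"
proof (rule closure_minimal)
  have "\<phi> g \<in> PiE X (\<lambda>_. X)" if "g \<in> carrier G" for g
    using that bij_prop0[OF that] act_closed[OF that] by (simp add: PiE_iff Bij_def)
  then show "\<phi> ` H \<subseteq> PiE X (\<lambda>_. X)"
    using assms by blast
  have "compact (PiE X (\<lambda>_. X))"
    by (rule compact_PiE) (rule compact)
  then show "closed (PiE X (\<lambda>_. X))"
    by (rule compact_imp_closed)
qed

lemma ellis_subset: "ellis \<subseteq> PiE X (\<lambda>_. X)"
  unfolding ellis_def by (rule closure_act_subset) simp

lemma compact_closure_act:
  assumes "H \<subseteq> carrier G"
  shows "compact (closure (\<phi> ` H))"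
proof -
  have "compact (PiE X (\<lambda>_. X))"
    by (rule compact_PiE) (rule compact)
  then have "compact (PiE X (\<lambda>_. X) \<inter> closure (\<phi> ` H))"
    by (rule compact_Int_closed) (rule closed_closure)
  also have "PiE X (\<lambda>_. X) \<inter> closure (\<phi> ` H) = closure (\<phi> ` H)"
    by (rule Int_absorb1[OF closure_act_subset[OF assms]])
  finally show ?thesis .
qed

lemma compact_ellis: "compact ellis"
  unfolding ellis_def by (rule compact_closure_act) simp

lemma act_in_ellis: "g \<in> carrier G \<Longrightarrow> \<phi> g \<in> ellis"
  unfolding ellis_def by (rule subsetD[OF closure_subset imageI])

lemma ellis_maps: "u \<in> ellis \<Longrightarrow> x \<in> X \<Longrightarrow> u x \<in> X"
  by (rule PiE_mem[OF subsetD[OF ellis_subset]])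

text \<open>Convergence is pointwise, so a neighbourhood of \<open>u\<close> may prescribe finitely
  many values up to \<open>\<epsilon>\<close>.\<close>

lemma closure_act_approx:
  assumes u: "u \<in> closure (\<phi> ` H)" and F: "finite F" and e: "\<epsilon> > 0"
  shows "\<exists>g\<in>H. \<forall>x\<in>F. dist (\<phi> g x) (u x) < \<epsilon>"
proof -
  let ?O = "{f. \<forall>x\<in>F. f x \<in> ball (u x) \<epsilon>}"
  have "open ?O" using product_topology_basis'[of F "\<lambda>x. ball (u x) \<epsilon>" "\<lambda>x. x"] F by simp
  moreover have "u \<in> ?O" using e by simp
  ultimately have "?O \<inter> \<phi> ` H \<noteq> {}"
    using u open_Int_closure_eq_empty by blast
  then obtain g where "g \<in> H" "\<forall>x\<in>F. dist (u x) (\<phi> g x) < \<epsilon>" by auto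
  then show ?thesis by (auto simp: dist_commute intro!: bexI[of _ g])
qed

lemma ellis_approx:
  "u \<in> ellis \<Longrightarrow> finite F \<Longrightarrow> \<epsilon> > 0 \<Longrightarrow> \<exists>g\<in>carrier G. \<forall>x\<in>F. dist (\<phi> g x) (u x) < \<epsilon>"
  unfolding ellis_def by (rule closure_act_approx)

lemma continuous_eval: "continuous_on S (\<lambda>p::'x \<Rightarrow> 'x. p z)"
  by (rule continuous_on_subset[OF continuous_on_product_coordinates subset_UNIV])

text \<open>The value of the composition at \<open>x\<close> is the evaluation of \<open>p\<close>
  at \<open>q x\<close>, which is continuous in \<open>p\<close> for every \<open>q\<close>.
  Continuity in the right factor requires more: it is established for left factors
  \<open>\<phi> g\<close>, which are continuous maps.\<close>

lemma continuous_compose_right: "continuous_on S (\<lambda>p::'x \<Rightarrow> 'x. compose X p q)"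
proof (rule continuous_on_coordinatewise_then_product)
  fix x
  show "continuous_on S (\<lambda>p::'x \<Rightarrow> 'x. compose X p q x)"
    unfolding compose_def restrict_def
    by (cases "x \<in> X") (simp_all add: continuous_eval)
qed

lemma continuous_compose_act:
  assumes g: "g \<in> carrier G"
  shows "continuous_on (PiE X (\<lambda>_. X)) (\<lambda>q. compose X (\<phi> g) q)"
proof (rule continuous_on_coordinatewise_then_product)
  fix x
  have "continuous_on (PiE X (\<lambda>_. X)) (\<lambda>q. \<phi> g (q x))" if "x \<in> X"
    by (rule continuous_on_compose2[OF continuous[OF g] continuous_eval]) (use that in auto)
  then show "continuous_on (PiE X (\<lambda>_. X)) (\<lambda>q. compose X (\<phi> g) q x)"
    unfolding compose_def restrict_def by (cases "x \<in> X") simp_all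
qed

lemma compose_act:
  assumes "g \<in> carrier G" "h \<in> carrier G"
  shows "compose X (\<phi> g) (\<phi> h) = \<phi> (g \<otimes> h)"
  by (rule extensionalityI[of _ X])
    (use assms bij_prop0 in \<open>auto simp: compose_eq composition_rule Bij_def\<close>)

text \<open>Two limits in succession: in the right factor for a fixed group element
  \<open>g\<close>, then in the left factor. The set \<open>B\<close> may depend on
  \<open>g\<close>, because the tail that can follow a finite product depends on that
  product.\<close>

lemma compose_in_closure:
  assumes "H \<subseteq> carrier G" "K \<subseteq> carrier G"
    and p: "p \<in> closure (\<phi> ` H)"
    and q: "\<And>g. g \<in> H \<Longrightarrow> \<exists>B\<subseteq>carrier G. q \<in> closure (\<phi> ` B) \<and> (\<forall>h\<in>B. g \<otimes> h \<in> K)"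
  shows "compose X p q \<in> closure (\<phi> ` K)"
proof -
  have "compose X (\<phi> g) q \<in> closure (\<phi> ` K)" if g: "g \<in> H" for g
  proof -
    obtain B where B: "B \<subseteq> carrier G" "q \<in> closure (\<phi> ` B)" "\<And>h. h \<in> B \<Longrightarrow> g \<otimes> h \<in> K"
      using q[OF g] by blast
    have gG: "g \<in> carrier G" using g assms(1) by blast
    have "(\<lambda>q. compose X (\<phi> g) q) ` closure (\<phi> ` B) \<subseteq> closure (\<phi> ` K)"
    proof (rule image_closure_subset)
      show "continuous_on (closure (\<phi> ` B)) (\<lambda>q. compose X (\<phi> g) q)"
        by (rule continuous_on_subset[OF continuous_compose_act[OF gG] closure_act_subset[OF B(1)]])
      have "compose X (\<phi> g) (\<phi> h) \<in> \<phi> ` K" if "h \<in> B" for h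
        using compose_act[OF gG] B(1,3) that by auto
      then show "(\<lambda>q. compose X (\<phi> g) q) ` \<phi> ` B \<subseteq> closure (\<phi> ` K)"
        by (intro subset_trans[OF _ closure_subset] image_subsetI) auto
    qed simp
    then show ?thesis using B(2) by blast
  qed
  then have "(\<lambda>p. compose X p q) ` closure (\<phi> ` H) \<subseteq> closure (\<phi> ` K)"
    by (intro image_closure_subset continuous_compose_right) auto
  then show ?thesis using p by blast
qed

lemma compose_act_ellis: "g \<in> carrier G \<Longrightarrow> p \<in> ellis \<Longrightarrow> compose X (\<phi> g) p \<in> ellis"
  unfolding ellis_def
  by (rule compose_in_closure[of "{g}"]) auto

text \<open>Only multiplication by group elements is demanded; for closed \<open>L\<close> a limit
  in the left factor extends it to all of \<open>ellis\<close>.\<close>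

definition left_ideal :: "('x \<Rightarrow> 'x) set \<Rightarrow> bool"
  where "left_ideal L \<longleftrightarrow> (\<forall>g\<in>carrier G. \<forall>p\<in>L. compose X (\<phi> g) p \<in> L)"

lemma left_ideal_compose:
  assumes L: "left_ideal L" "closed L" and p: "p \<in> ellis" and q: "q \<in> L"
  shows "compose X p q \<in> L"
proof -
  have "(\<lambda>p. compose X p q) ` closure (\<phi> ` carrier G) \<subseteq> L"
    by (rule image_closure_subset[OF continuous_compose_right L(2)])
      (use L(1) q in \<open>auto simp: left_ideal_def\<close>)
  then show ?thesis using p by (auto simp: ellis_def)
qed

lemma exists_idempotent:
  assumes S: "compact S" "S \<noteq> {}" "S \<subseteq> ellis"
    and closed: "\<And>p q. p \<in> S \<Longrightarrow> q \<in> S \<Longrightarrow> compose X p q \<in> S"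
  obtains u where "u \<in> S" "\<And>x. x \<in> X \<Longrightarrow> u (u x) = u x"
proof -
  have assoc: "compose X (compose X p q) r = compose X p (compose X q r)" if "r \<in> S" for p q r
    using that S(3) ellis_subset compose_assoc[of r X X p q] by (auto simp: PiE_def)
  obtain u where u: "u \<in> S" "compose X u u = u"
    by (rule Ellis_Numakura[OF S(1,2) continuous_compose_right closed assoc])
  then have "u (u x) = u x" if "x \<in> X" for x
    using compose_eq[OF that, of u u] by simp
  then show thesis using that u(1) by blast
qed

text \<open>One group element approximates \<open>u\<close> at both \<open>x\<close> and
  \<open>u x\<close>, and \<open>u\<close> sends both to \<open>u x\<close>.\<close>

lemma idempotent_proximal:
  assumes u: "u \<in> ellis" "\<And>x. x \<in> X \<Longrightarrow> u (u x) = u x" and x: "x \<in> X"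
  shows "proximal_pair G \<phi> x (u x)"
  unfolding proximal_pair_iff[OF is_group]
proof (intro allI impI)
  fix \<epsilon> :: real assume "\<epsilon> > 0"
  then obtain g where "g \<in> carrier G" "\<forall>z\<in>{x, u x}. dist (\<phi> g z) (u z) < \<epsilon> / 2"
    using ellis_approx[OF u(1), of "{x, u x}" "\<epsilon> / 2"] by auto
  then show "\<exists>g\<in>carrier G. dist (\<phi> g x) (\<phi> g (u x)) < \<epsilon>"
    using u(2)[OF x] dist_triangle_half_l[of "\<phi> g x" "u x" \<epsilon> "\<phi> g (u x)"]
    by (intro bexI[of _ g]) auto
qed

lemma not_distal_pair_iff: "\<not> distal_pair G \<phi> x y \<longleftrightarrow> proximal_pair G \<phi> x y"
proof -
  have "(INF g\<in>carrier G. dist (\<phi> g x) (\<phi> g y)) \<ge> 0"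
    by (rule cINF_greatest) auto
  then show ?thesis by (auto simp: distal_pair_def proximal_pair_def)
qed

lemma proximal_left_ideal:
  assumes x: "x \<in> X" and y: "y \<in> X" and prox: "proximal_pair G \<phi> x y"
  defines "I \<equiv> {p \<in> ellis. p x = p y}"
  shows "compact I" "I \<noteq> {}" "left_ideal I"
proof -
  have "closed {p::'x \<Rightarrow> 'x. p x = p y}"
    by (intro closed_Collect_eq continuous_eval)
  moreover have "I = ellis \<inter> {p. p x = p y}" by (auto simp: I_def)
  ultimately show "compact I" using compact_Int_closed[OF compact_ellis] by simp
  show "left_ideal I"
    using compose_act_ellis x y by (auto simp: left_ideal_def I_def compose_eq)
  \<comment> \<open>The distance from \<open>p x\<close> to \<open>p y\<close> attains its minimum
    on the compact set \<open>ellis\<close>, and proximality makes that minimum zero.\<close>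
  have "continuous_on ellis (\<lambda>p. dist (p x) (p y))" by (intro continuous_intros continuous_eval)
  moreover have "ellis \<noteq> {}" using act_in_ellis one_closed by blast
  ultimately obtain p where p: "p \<in> ellis" "\<And>q. q \<in> ellis \<Longrightarrow> dist (p x) (p y) \<le> dist (q x) (q y)"
    using continuous_attains_inf[OF compact_ellis] by blast
  have "dist (p x) (p y) \<le> 0"
  proof (rule field_le_epsilon)
    fix \<epsilon> :: real assume "\<epsilon> > 0"
    then obtain g where "g \<in> carrier G" "dist (\<phi> g x) (\<phi> g y) < \<epsilon>"
      using prox by (auto simp: proximal_pair_iff[OF is_group])
    then show "dist (p x) (p y) \<le> 0 + \<epsilon>" using p(2)[OF act_in_ellis, of g] by simp
  qed
  then show "I \<noteq> {}" using p(1) by (auto simp: I_def)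
qed

lemma minimal_pointE:
  assumes "minimal_point G X \<phi> y"
  obtains M where "y \<in> M" "M \<subseteq> X" "closed M" "ginvariant G \<phi> M"
    "\<And>Y. Y \<subseteq> M \<Longrightarrow> Y \<noteq> {} \<Longrightarrow> closed Y \<Longrightarrow> ginvariant G \<phi> Y \<Longrightarrow> Y = M"
proof -
  obtain M where M: "closedin (top_of_set X) M" "ginvariant G \<phi> M" "minimal_system G M \<phi>" "y \<in> M"
    using assms by (auto simp: minimal_point_def)
  have "closed M" "M \<subseteq> X"
    using M(1) closedin_closed_trans compact_imp_closed[OF compact] closedin_subset by fastforce+
  moreover have "Y = M" if "Y \<subseteq> M" "Y \<noteq> {}" "closed Y" "ginvariant G \<phi> Y" for Y
    using M(3) that closed_subset unfolding minimal_system_def by blast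
  ultimately show thesis using that M by blast
qed

text \<open>The maps identifying \<open>x\<close> and \<open>y\<close> form a closed left ideal
  \<open>I\<close>, and \<open>I y\<close> is a closed invariant subset of the minimal set around
  \<open>y\<close>, hence all of it. So some map in \<open>I\<close> fixes \<open>y\<close>. Such
  maps form a compact semigroup, and an idempotent \<open>u\<close> in it has
  \<open>u x = u y = y\<close>.\<close>

lemma Auslander_Ellis:
  assumes x: "x \<in> X" and prox: "proximal_pair G \<phi> x y" and min: "minimal_point G X \<phi> y"
  obtains u where "u \<in> ellis" "\<And>x. x \<in> X \<Longrightarrow> u (u x) = u x" "u x = y"
proof -
  obtain M where M: "y \<in> M" "M \<subseteq> X" "closed M" "ginvariant G \<phi> M"
    and M_min: "\<And>Y. Y \<subseteq> M \<Longrightarrow> Y \<noteq> {} \<Longrightarrow> closed Y \<Longrightarrow> ginvariant G \<phi> Y \<Longrightarrow> Y = M"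
    by (rule minimal_pointE[OF min]) blast
  have y: "y \<in> X" using M by blast
  define I where "I = {p \<in> ellis. p x = p y}"
  note I = proximal_left_ideal[OF x y prox, folded I_def]
  have "(\<lambda>p. p y) ` I = M"
  proof (rule M_min)
    have "(\<lambda>p. p y) ` closure (\<phi> ` carrier G) \<subseteq> M"
      by (rule image_closure_subset[OF continuous_eval M(3)]) (use M in \<open>auto simp: ginvariant_def\<close>)
    then show "(\<lambda>p. p y) ` I \<subseteq> M" by (auto simp: I_def ellis_def)
    show "closed ((\<lambda>p. p y) ` I)"
      by (intro compact_imp_closed compact_continuous_image I continuous_eval)
    show "ginvariant G \<phi> ((\<lambda>p. p y) ` I)"
      unfolding ginvariant_def
    proof (intro ballI subsetI)
      fix g z assume g: "g \<in> carrier G" and "z \<in> \<phi> g ` (\<lambda>p. p y) ` I"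
      then obtain p where p: "p \<in> I" "z = compose X (\<phi> g) p y" by (auto simp: compose_eq y)
      then show "z \<in> (\<lambda>p. p y) ` I" using I(3) g by (auto simp: left_ideal_def)
    qed
  qed (use I in simp)
  then obtain p where p: "p \<in> I" "p y = y" using M(1) by (metis imageE)
  define S where "S = I \<inter> {p. p y = y}"
  have "closed {p::'x \<Rightarrow> 'x. p y = y}"
    by (intro closed_Collect_eq continuous_eval continuous_on_const)
  then have "compact S" unfolding S_def by (rule compact_Int_closed[OF I(1)])
  moreover have "S \<noteq> {}" using p by (auto simp: S_def)
  moreover have "S \<subseteq> ellis" by (auto simp: S_def I_def)
  moreover have "compose X p q \<in> S" if "p \<in> S" "q \<in> S" for p q
    using left_ideal_compose[OF I(3) compact_imp_closed[OF I(1)], of p q] that y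
    by (auto simp: S_def compose_eq I_def)
  ultimately obtain u where "u \<in> S" "\<And>x. x \<in> X \<Longrightarrow> u (u x) = u x"
    by (rule exists_idempotent) auto
  then show thesis using that by (auto simp: S_def I_def)
qed


subsection \<open>IP-sets of return times\<close>

text \<open>The last factor brings \<open>x\<close> into some \<open>S k\<close>, and each earlier
  factor \<open>g k\<close> takes \<open>S (Suc k)\<close> into \<open>S k\<close>. Nestedness of
  the sets accounts for the skipped indices.\<close>

lemma FP_from_hits:
  assumes g: "\<And>k. g k \<in> carrier G" and x: "x \<in> X"
    and S: "\<And>k. S (Suc k) \<subseteq> S k" "\<And>k. \<phi> (g k) ` S (Suc k) \<subseteq> S k" "\<And>k. \<phi> (g k) x \<in> S k"
    and h: "h \<in> FP_from G g n"
  shows "\<phi> h x \<in> S n"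
proof -
  have anti: "n \<le> k \<Longrightarrow> S k \<subseteq> S n" for n k
    by (rule lift_Suc_antimono_le[of S]) (use S in auto)
  show ?thesis using h
  proof (induction rule: FP_from_induct)
    case (single n k)
    then show ?case using anti S(3) by blast
  next
    case (cons n k h)
    have "h \<in> carrier G" by (rule FP_from_closed[OF _ cons.hyps(2)]) (use g in auto)
    then have "\<phi> (g k \<otimes> h) x = \<phi> (g k) (\<phi> h x)" using composition_rule x g by simp
    also have "\<dots> \<in> S k" using S(2) cons.IH by blast
    finally show ?case using anti[OF cons.hyps(1)] by blast
  qed
qed

text \<open>Since \<open>u\<close> sends both \<open>x\<close> and \<open>u x\<close> to
  \<open>u x\<close>, every neighbourhood \<open>W\<close> of \<open>u x\<close> admits a
  \<open>g\<close> bringing both points into \<open>W\<close>. The points of \<open>W\<close> that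
  \<open>g\<close> keeps in \<open>W\<close> again form a neighbourhood of \<open>u x\<close>, so
  the choice can be repeated.\<close>

lemma idempotent_hitting_IP_set:
  assumes u: "u \<in> ellis" "\<And>x. x \<in> X \<Longrightarrow> u (u x) = u x" and x: "x \<in> X" and U: "nbhd X (u x) U"
  shows "IP_set G (hitting G \<phi> x U)"
proof -
  obtain V where V: "openin (top_of_set X) V" "u x \<in> V" "V \<subseteq> U"
    using U by (auto simp: nbhd_def)
  define P where "P W \<longleftrightarrow> openin (top_of_set X) W \<and> u x \<in> W \<and> W \<subseteq> V" for W
  define Q where "Q W W' g \<longleftrightarrow> g \<in> carrier G \<and> \<phi> g x \<in> W \<and> W' \<subseteq> W \<and> \<phi> g ` W' \<subseteq> W" for W W' g
  have "\<exists>W'. P W' \<and> (\<exists>g. Q W W' g)" if W: "P W" for W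
  proof -
    obtain \<epsilon> where e: "\<epsilon> > 0" "\<And>w. w \<in> X \<Longrightarrow> dist w (u x) < \<epsilon> \<Longrightarrow> w \<in> W"
      using W unfolding P_def openin_euclidean_subtopology_iff by blast
    obtain g where g: "g \<in> carrier G" "\<And>z. z \<in> {x, u x} \<Longrightarrow> dist (\<phi> g z) (u z) < \<epsilon>"
      using ellis_approx[OF u(1), of "{x, u x}" \<epsilon>] e(1) by auto
    have gW: "\<phi> g x \<in> W" "\<phi> g (u x) \<in> W"
      using g(2)[of x] g(2)[of "u x"] u(2)[OF x] g(1) x
      by (auto intro!: e(2) act_closed ellis_maps[OF u(1)])
    have "openin (top_of_set X) (X \<inter> \<phi> g -` W)"
      by (rule continuous_openin_preimage[OF continuous[OF g(1)], where T = X])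
        (use W act_closed[OF g(1)] in \<open>auto simp: P_def\<close>)
    then have "P (W \<inter> (X \<inter> \<phi> g -` W))"
      using W gW u(1) x ellis_maps by (auto simp: P_def intro: openin_Int)
    then show ?thesis
      using gW g by (intro exI[of _ "W \<inter> (X \<inter> \<phi> g -` W)"]) (auto simp: Q_def)
  qed
  then have "\<exists>S. \<forall>n. P (S n) \<and> (\<exists>g. Q (S n) (S (Suc n)) g)"
    by (intro dependent_nat_choice) (use V in \<open>auto simp: P_def\<close>)
  then obtain S g where S: "\<And>n. P (S n)" "\<And>n. Q (S n) (S (Suc n)) (g n)" by metis
  have gG: "range g \<subseteq> carrier G" using S(2) by (auto simp: Q_def)
  have "\<phi> h x \<in> S 0" if "h \<in> FP_from G g 0" for h
    by (rule FP_from_hits[OF _ x _ _ _ that]) (use S(2) in \<open>auto simp: Q_def\<close>)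
  moreover have "S 0 \<subseteq> U" using S(1)[of 0] V(3) by (auto simp: P_def)
  ultimately have "FP_from G g 0 \<subseteq> hitting G \<phi> x U"
    using FP_from_closed[OF gG] by (auto simp: hitting_def)
  then show ?thesis by (rule IP_setI[OF gG]) (auto simp: hitting_def)
qed

lemma proximal_minimal_hitting_IP_set:
  assumes "x \<in> X" "proximal_pair G \<phi> x y" "minimal_point G X \<phi> y" "nbhd X y U"
  shows "IP_set G (hitting G \<phi> x U)"
  using Auslander_Ellis[OF assms(1-3)] idempotent_hitting_IP_set assms(1,4) by metis

end

section \<open>Central sets are IP-sets\<close>

lemma central_set_imp_IP_set:
  assumes "central_set G F"
  shows "IP_set G F"
proof -
  obtain Z \<psi> and x y :: "nat \<Rightarrow> real" and U where
    *: "dyn_system G Z \<psi>" "x \<in> Z" "nbhd Z y U" "proximal_pair G \<psi> x y" "minimal_point G Z \<psi> y"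
      "hitting G \<psi> x U \<subseteq> F" "F \<subseteq> carrier G"
    using assms unfolding central_set_def by blast
  interpret dyn_system G Z \<psi> by fact
  show ?thesis
    using proximal_minimal_hitting_IP_set[OF *(2,4,5,3)] *(6,7) unfolding IP_set_def by blast
qed

lemma IP_star_set_imp_central_star_set: "IP_star_set G F \<Longrightarrow> central_star_set G F"
  using central_set_imp_IP_set unfolding IP_star_set_def central_star_set_def by blast

lemma pairwise_IP_star_imp_central_star_equicont:
  "pairwise_IP_star_equicont G X \<phi> \<Longrightarrow> pairwise_central_star_equicont G X \<phi>"
  using IP_star_set_imp_central_star_set
  unfolding pairwise_IP_star_equicont_def pairwise_central_star_equicont_def
    pairwise_equicont_point_def by blast

section \<open>Idempotents along an IP-set, and distal systems\<close>

context dyn_system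
begin

text \<open>The closures of all tails have a common point by compactness. Their intersection is a
  semigroup: an element of one tail can be followed by everything in some later tail, and a map in
  the intersection is also a limit along that later tail.\<close>

lemma FP_idempotent:
  assumes p: "range p \<subseteq> carrier G"
  obtains u where "u \<in> closure (\<phi> ` FP_from G p 0)" "\<And>x. x \<in> X \<Longrightarrow> u (u x) = u x"
proof -
  define C where "C n = closure (\<phi> ` FP_from G p n)" for n
  have FG: "FP_from G p n \<subseteq> carrier G" for n using FP_from_closed[OF p] by blast
  have CE: "C n \<subseteq> ellis" for n
    unfolding C_def ellis_def by (intro closure_mono image_mono FG)
  have "ellis \<inter> (\<Inter>n\<in>UNIV. C n) \<noteq> {}"
  proof (rule compact_imp_fip_image[OF compact_ellis])
    fix J :: "nat set" assume J: "finite J"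
    \<comment> \<open>A term whose index bounds all of \<open>J\<close> lies in every tail
      considered; inserting 0 covers the empty \<open>J\<close>.\<close>
    define k where "k = Max (insert 0 J)"
    have "\<phi> (p k) \<in> C n" if "n \<in> J" for n
      unfolding C_def using J that
      by (intro subsetD[OF closure_subset] imageI FP_from_single) (simp add: k_def)
    then show "ellis \<inter> (\<Inter>n\<in>J. C n) \<noteq> {}" using act_in_ellis[of "p k"] p by blast
  qed (simp add: C_def)
  moreover have "(\<Inter>n. C n) \<subseteq> ellis" using CE by blast
  moreover from this have "compact (\<Inter>n. C n)"
    using compact_Int_closed[OF compact_ellis, of "\<Inter>n. C n"] by (auto simp: C_def Int_absorb1)
  moreover have "compose X q r \<in> (\<Inter>n. C n)" if q: "q \<in> (\<Inter>n. C n)" and r: "r \<in> (\<Inter>n. C n)" for q r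
  proof
    fix n
    show "compose X q r \<in> C n" unfolding C_def
    proof (rule compose_in_closure[OF FG FG])
      show "q \<in> closure (\<phi> ` FP_from G p n)" using q by (auto simp: C_def)
      fix g assume "g \<in> FP_from G p n"
      then obtain m where "\<forall>k\<in>FP_from G p m. g \<otimes> k \<in> FP_from G p n"
        using FP_from_mult[OF p] by blast
      then show "\<exists>B\<subseteq>carrier G. r \<in> closure (\<phi> ` B) \<and> (\<forall>h\<in>B. g \<otimes> h \<in> FP_from G p n)"
        using r FG by (intro exI[of _ "FP_from G p m"]) (auto simp: C_def)
    qed
  qed
  ultimately obtain u where "u \<in> (\<Inter>n. C n)" "\<And>x. x \<in> X \<Longrightarrow> u (u x) = u x"
    by (elim exists_idempotent[rotated -1]) auto
  then show thesis using that by (auto simp: C_def)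
qed

lemma nbhd_ball: "x \<in> X \<Longrightarrow> r > 0 \<Longrightarrow> nbhd X x (X \<inter> ball x r)"
  unfolding nbhd_def by (intro conjI exI[of _ "X \<inter> ball x r"]) (auto intro: openin_open_Int)

text \<open>An idempotent in the closure of the IP-set is proximal to the identity at each point, so
  by distality it is the identity on \<open>X\<close>. Some element \<open>g\<close> of the IP-set
  therefore moves \<open>y\<close> and \<open>z\<close> by less than \<open>\<epsilon>/4\<close>,
  and the path from \<open>\<phi> g y\<close> through \<open>y\<close>, \<open>x\<close>,
  \<open>z\<close> to \<open>\<phi> g z\<close> has four such steps.\<close>

lemma distal_imp_pairwise_IP_star_equicont:
  assumes "distal_system G X \<phi>"
  shows "pairwise_IP_star_equicont G X \<phi>"
  unfolding pairwise_IP_star_equicont_def pairwise_equicont_point_def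
proof (intro ballI allI impI)
  fix x and \<epsilon> :: real assume x: "x \<in> X" and e: "\<epsilon> > 0"
  have "IP_star_set G {g \<in> carrier G. dist (\<phi> g y) (\<phi> g z) < \<epsilon>}" (is "IP_star_set G ?F")
    if y: "y \<in> X \<inter> ball x (\<epsilon>/4)" and z: "z \<in> X \<inter> ball x (\<epsilon>/4)" for y z
    unfolding IP_star_set_def
  proof (intro conjI allI impI)
    fix E assume "IP_set G E"
    then obtain p where p: "range p \<subseteq> carrier G" "FP_from G p 0 \<subseteq> E" by (rule IP_setE)
    obtain u where u: "u \<in> closure (\<phi> ` FP_from G p 0)" "\<And>x. x \<in> X \<Longrightarrow> u (u x) = u x"
      by (rule FP_idempotent[OF p(1)]) blast
    have "FP_from G p 0 \<subseteq> carrier G" using FP_from_closed[OF p(1)] by blast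
    then have "u \<in> ellis"
      unfolding ellis_def by (intro subsetD[OF closure_mono[OF image_mono] u(1)])
    then have fixed: "u w = w" if "w \<in> X" for w
      using idempotent_proximal[OF _ u(2) that] ellis_maps that assms not_distal_pair_iff
      unfolding distal_system_def by metis
    obtain g where g: "g \<in> FP_from G p 0" "\<And>w. w \<in> {y, z} \<Longrightarrow> dist (\<phi> g w) (u w) < \<epsilon>/4"
      using closure_act_approx[OF u(1), of "{y, z}" "\<epsilon>/4"] e by auto
    have "dist (\<phi> g y) y < \<epsilon>/4" "dist (\<phi> g z) z < \<epsilon>/4"
      using g(2)[of y] g(2)[of z] y z fixed[of y] fixed[of z] by auto
    moreover have "dist x y < \<epsilon>/4" "dist x z < \<epsilon>/4" using y z by auto
    ultimately have "dist (\<phi> g y) (\<phi> g z) < \<epsilon>" by metric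
    then have "g \<in> ?F \<inter> E" using g(1) p FP_from_closed[OF p(1)] by auto
    then show "?F \<inter> E \<noteq> {}" by blast
  qed auto
  then show "\<exists>U. nbhd X x U \<and> (\<forall>y\<in>U. \<forall>z\<in>U. IP_star_set G {g \<in> carrier G. dist (\<phi> g y) (\<phi> g z) < \<epsilon>})"
    using nbhd_ball[OF x, of "\<epsilon>/4"] e by (intro exI[of _ "X \<inter> ball x (\<epsilon>/4)"]) auto
qed

lemma pairwise_equicont_pointD:
  assumes "pairwise_equicont_point large G X \<phi> x" "\<epsilon> > 0"
  obtains \<delta> where "\<delta> > 0"
    "\<And>y z. y \<in> X \<Longrightarrow> z \<in> X \<Longrightarrow> dist y x < \<delta> \<Longrightarrow> dist z x < \<delta> \<Longrightarrow>
      large {g \<in> carrier G. dist (\<phi> g y) (\<phi> g z) < \<epsilon>}"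
proof -
  obtain U where U: "nbhd X x U"
    "\<And>y z. y \<in> U \<Longrightarrow> z \<in> U \<Longrightarrow> large {g \<in> carrier G. dist (\<phi> g y) (\<phi> g z) < \<epsilon>}"
    using assms unfolding pairwise_equicont_point_def by blast
  obtain V where V: "openin (top_of_set X) V" "x \<in> V" "V \<subseteq> U" using U(1) by (auto simp: nbhd_def)
  then obtain \<delta> where "\<delta> > 0" "\<And>y. y \<in> X \<Longrightarrow> dist y x < \<delta> \<Longrightarrow> y \<in> V"
    unfolding openin_euclidean_subtopology_iff by blast
  then show thesis using that U(2) V(3) by blast
qed


subsection \<open>The product system\<close>

lemma diag_action_Pair [simp]:
  "p \<in> X \<Longrightarrow> q \<in> X \<Longrightarrow> diag_action X \<phi> g (p, q) = (\<phi> g p, \<phi> g q)"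
  by (simp add: diag_action_def)

text \<open>The times at which \<open>(p, q)\<close> comes near \<open>(r, s)\<close> form a central
  set, so at one of them \<open>\<phi> g p\<close> and \<open>\<phi> g q\<close> are also within
  \<open>\<epsilon>\<close>. The error \<open>\<eta>\<close> is arbitrary.\<close>

lemma central_star_dist_le:
  assumes pq: "p \<in> X" "q \<in> X" and rs: "r \<in> X" "s \<in> X"
    and min: "minimal_point G (X \<times> X) (diag_action X \<phi>) (r, s)"
    and prox: "proximal_pair G (diag_action X \<phi>) (p, q) (r, s)"
    and central: "central_star_set G {g \<in> carrier G. dist (\<phi> g p) (\<phi> g q) < \<epsilon>}"
  shows "dist r s \<le> \<epsilon>"
proof (rule field_le_epsilon)
  fix \<eta> :: real assume "\<eta> > 0"
  define U where "U = (X \<times> X) \<inter> (ball r (\<eta>/2) \<times> ball s (\<eta>/2))"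
  have "openin (top_of_set (X \<times> X)) U"
    unfolding U_def by (intro openin_open_Int open_Times open_ball)
  then have "nbhd (X \<times> X) (r, s) U"
    using rs \<open>\<eta> > 0\<close> unfolding nbhd_def by (intro conjI exI[of _ U]) (auto simp: U_def)
  then have "central_set G (hitting G (diag_action X \<phi>) (p, q) U)"
    using pq rs by (intro central_setI[OF dyn_system_diag _ _ _ prox min]) (auto simp: hitting_def)
  then have "{g \<in> carrier G. dist (\<phi> g p) (\<phi> g q) < \<epsilon>} \<inter> hitting G (diag_action X \<phi>) (p, q) U \<noteq> {}"
    using central unfolding central_star_set_def by blast
  then obtain g where g: "dist (\<phi> g p) (\<phi> g q) < \<epsilon>" "diag_action X \<phi> g (p, q) \<in> U"
    by (auto simp: hitting_def)
  then have "dist r (\<phi> g p) < \<eta>/2" "dist s (\<phi> g q) < \<eta>/2" using pq by (auto simp: U_def)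
  then show "dist r s \<le> \<epsilon> + \<eta>" using g(1) by metric
qed

text \<open>One group element approximates \<open>u\<close> at the four points \<open>p\<close>,
  \<open>q\<close>, \<open>u p\<close>, \<open>u q\<close> simultaneously.\<close>

lemma idempotent_diag_proximal:
  assumes u: "u \<in> ellis" "\<And>x. x \<in> X \<Longrightarrow> u (u x) = u x" and pq: "p \<in> X" "q \<in> X"
  shows "proximal_pair G (diag_action X \<phi>) (p, q) (u p, u q)"
  unfolding proximal_pair_iff[OF is_group]
proof (intro allI impI)
  fix \<epsilon> :: real assume "\<epsilon> > 0"
  then obtain g where g: "g \<in> carrier G"
    and close: "\<And>z. z \<in> {p, q, u p, u q} \<Longrightarrow> dist (\<phi> g z) (u z) < \<epsilon>/4"
    using ellis_approx[OF u(1), of "{p, q, u p, u q}" "\<epsilon>/4"] by auto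
  have "dist (\<phi> g z) (\<phi> g (u z)) < \<epsilon>/2" if "z \<in> {p, q}" for z
  proof -
    have "u (u z) = u z" using that u(2) pq by auto
    then have "dist (\<phi> g z) (u z) < \<epsilon>/4" "dist (\<phi> g (u z)) (u z) < \<epsilon>/4"
      using close[of z] close[of "u z"] that by auto
    then show ?thesis by metric
  qed
  then have "dist (\<phi> g p, \<phi> g q) (\<phi> g (u p), \<phi> g (u q)) < \<epsilon>"
    unfolding dist_Pair_Pair by (intro sqrt_sum_squares_half_less) auto
  then show "\<exists>g\<in>carrier G. dist (diag_action X \<phi> g (p, q)) (diag_action X \<phi> g (u p, u q)) < \<epsilon>"
    using g pq ellis_maps[OF u(1)] by (intro bexI[of _ g]) simp_all
qed

text \<open>The idempotent is taken in a minimal closed left ideal \<open>L\<close> of maps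
  identifying \<open>x\<close> and \<open>y\<close>. Evaluation at \<open>(p, q)\<close> is
  continuous and equivariant, so a smaller closed invariant subset of its image would pull back to a
  smaller left ideal. The image of \<open>L\<close> is thus a minimal set containing
  \<open>(u p, u q)\<close>.\<close>

lemma proximal_collapsing_idempotent:
  assumes x: "x \<in> X" and y: "y \<in> X" and prox: "proximal_pair G \<phi> x y"
  obtains u where "u \<in> ellis" "\<And>z. z \<in> X \<Longrightarrow> u (u z) = u z" "u x = u y"
    "\<And>p q. p \<in> X \<Longrightarrow> q \<in> X \<Longrightarrow> minimal_point G (X \<times> X) (diag_action X \<phi>) (u p, u q)"
proof -
  define I where "I = {p \<in> ellis. p x = p y}"
  note I = proximal_left_ideal[OF x y prox, folded I_def]
  obtain L where L: "L \<subseteq> I" "compact L" "L \<noteq> {}" "left_ideal L"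
    and L_min: "\<And>K. K \<subseteq> L \<Longrightarrow> compact K \<Longrightarrow> K \<noteq> {} \<Longrightarrow> left_ideal K \<Longrightarrow> K = L"
  proof (rule exists_minimal_compact[of I left_ideal])
    show "left_ideal (\<Inter>C)" if "C \<noteq> {}" "\<And>T. T \<in> C \<Longrightarrow> left_ideal T" for C
      using that by (auto simp: left_ideal_def)
  qed (use I in auto)
  have LE: "L \<subseteq> ellis" using L(1) by (auto simp: I_def)
  obtain u where u: "u \<in> L" "\<And>z. z \<in> X \<Longrightarrow> u (u z) = u z"
  proof (rule exists_idempotent[OF L(2,3) LE])
    show "compose X p q \<in> L" if "p \<in> L" "q \<in> L" for p q
      using left_ideal_compose[OF L(4) compact_imp_closed[OF L(2)]] that LE by blast
  qed blast
  have "minimal_point G (X \<times> X) (diag_action X \<phi>) (u p, u q)" if p: "p \<in> X" and q: "q \<in> X" for p q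
  proof -
    let ?e = "\<lambda>l. (l p, l q)"
    have cont: "continuous_on S ?e" for S :: "('x \<Rightarrow> 'x) set"
      by (intro continuous_on_Pair continuous_eval)
    have sub: "?e ` L \<subseteq> X \<times> X" using LE ellis_maps p q by blast
    have act: "diag_action X \<phi> g (?e l) = ?e (compose X (\<phi> g) l)" if "l \<in> L" for g l
      using sub that p q by (auto simp: compose_eq)
    have "compact (?e ` L)" by (rule compact_continuous_image[OF cont L(2)])
    then have cl: "closed (?e ` L)" by (rule compact_imp_closed)
    have inv: "ginvariant G (diag_action X \<phi>) (?e ` L)"
      using L(4) by (auto simp: ginvariant_def left_ideal_def act)
    have "Y = ?e ` L"
      if Y: "Y \<subseteq> ?e ` L" "Y \<noteq> {}" "closedin (top_of_set (?e ` L)) Y"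
        "ginvariant G (diag_action X \<phi>) Y" for Y
    proof -
      have "closed Y" by (rule closedin_closed_trans[OF Y(3) cl])
      then have "closed (UNIV \<inter> ?e -` Y)"
        by (intro continuous_closed_preimage cont closed_UNIV)
      then have "compact (L \<inter> (UNIV \<inter> ?e -` Y))" by (rule compact_Int_closed[OF L(2)])
      moreover have "left_ideal (L \<inter> (UNIV \<inter> ?e -` Y))"
        unfolding left_ideal_def
      proof (intro ballI)
        fix g l assume g: "g \<in> carrier G" and l: "l \<in> L \<inter> (UNIV \<inter> ?e -` Y)"
        then have "diag_action X \<phi> g (?e l) \<in> Y" using Y(4) by (auto simp: ginvariant_def)
        then show "compose X (\<phi> g) l \<in> L \<inter> (UNIV \<inter> ?e -` Y)"
          using g l L(4) act by (auto simp: left_ideal_def)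
      qed
      moreover have "L \<inter> (UNIV \<inter> ?e -` Y) \<noteq> {}" using Y(1,2) by blast
      ultimately have "L \<inter> (UNIV \<inter> ?e -` Y) = L" by (intro L_min) auto
      then show ?thesis using Y(1) by blast
    qed
    then have "minimal_system G (?e ` L) (diag_action X \<phi>)"
      unfolding minimal_system_def by blast
    then show ?thesis
      unfolding minimal_point_def using u(1) inv closed_subset[OF sub cl]
      by (intro exI[of _ "?e ` L"]) auto
  qed
  then show thesis using that u L(1) by (auto simp: I_def)
qed

text \<open>A minimal idempotent \<open>u\<close> with \<open>u x = u y\<close> is continuous at \<open>x\<close> and \<open>y\<close>, so it brings a
  minimal pair \<open>(a, b)\<close> near \<open>(x, y)\<close> close together; but \<open>(u a, u b)\<close> is proximal to \<open>(a, b)\<close>,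
  and equicontinuity at \<open>u x\<close> then forces \<open>a\<close> and \<open>b\<close> to be close.\<close>

lemma pairwise_central_star_equicont_imp_distal:
  assumes equi: "pairwise_central_star_equicont G X \<phi>"
    and dense: "X \<times> X \<subseteq> closure {p \<in> X \<times> X. minimal_point G (X \<times> X) (diag_action X \<phi>) p}"
  shows "distal_system G X \<phi>"
proof (rule ccontr)
  assume "\<not> distal_system G X \<phi>"
  then obtain x y where xy: "x \<in> X" "y \<in> X" "x \<noteq> y" and prox: "proximal_pair G \<phi> x y"
    unfolding distal_system_def using not_distal_pair_iff by blast
  obtain u where u: "u \<in> ellis" "\<And>z. z \<in> X \<Longrightarrow> u (u z) = u z" "u x = u y"
    and u_min: "\<And>p q. p \<in> X \<Longrightarrow> q \<in> X \<Longrightarrow> minimal_point G (X \<times> X) (diag_action X \<phi>) (u p, u q)"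
    by (rule proximal_collapsing_idempotent[OF xy(1,2) prox]) (rule that)
  have point: "pairwise_equicont_point (central_star_set G) G X \<phi> z" if "z \<in> X" for z
    using equi that by (auto simp: pairwise_central_star_equicont_def)
  \<comment> \<open>The pair \<open>(u z, u p)\<close> is minimal and proximal to
    \<open>(z, p)\<close>, so equicontinuity at \<open>z\<close> bounds its distance once
    \<open>p\<close> is near \<open>z\<close>.\<close>
  have u_cont: "\<exists>\<eta>>0. \<forall>p\<in>X. dist p z < \<eta> \<longrightarrow> dist (u z) (u p) < \<delta>" if z: "z \<in> X" and "\<delta> > 0" for z \<delta>
  proof -
    obtain \<eta> where \<eta>: "\<eta> > 0" "\<And>p q. p \<in> X \<Longrightarrow> q \<in> X \<Longrightarrow> dist p z < \<eta> \<Longrightarrow> dist q z < \<eta> \<Longrightarrow>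
        central_star_set G {g \<in> carrier G. dist (\<phi> g p) (\<phi> g q) < \<delta>/2}"
      by (rule pairwise_equicont_pointD[OF point[OF z] half_gt_zero[OF \<open>\<delta> > 0\<close>]]) (rule that)
    have le: "dist (u z) (u p) \<le> \<delta>/2" if p: "p \<in> X" "dist p z < \<eta>" for p
      by (rule central_star_dist_le[OF z p(1) ellis_maps[OF u(1) z] ellis_maps[OF u(1) p(1)]
            u_min[OF z p(1)] idempotent_diag_proximal[OF u(1,2) z p(1)] \<eta>(2)[OF z p(1) _ p(2)]])
        (use \<eta>(1) in simp_all)
    have half: "\<delta>/2 < \<delta>" using \<open>\<delta> > 0\<close> by simp
    show ?thesis
      using \<eta>(1) le_less_trans[OF le half] by (intro exI[of _ \<eta>] conjI ballI impI)
  qed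
  \<comment> \<open>The path from \<open>x\<close> through \<open>a\<close> and \<open>b\<close> to
    \<open>y\<close> will have three steps of at most \<open>\<epsilon>\<close>, too few to cover
    \<open>dist x y\<close>.\<close>
  define \<epsilon> where "\<epsilon> = dist x y / 4"
  have e: "\<epsilon> > 0" using xy by (simp add: \<epsilon>_def)
  obtain \<delta> where \<delta>: "\<delta> > 0" "\<And>p q. p \<in> X \<Longrightarrow> q \<in> X \<Longrightarrow> dist p (u x) < \<delta> \<Longrightarrow> dist q (u x) < \<delta> \<Longrightarrow>
      central_star_set G {g \<in> carrier G. dist (\<phi> g p) (\<phi> g q) < \<epsilon>}"
    by (rule pairwise_equicont_pointD[OF point[OF ellis_maps[OF u(1) xy(1)]] e]) (rule that)
  obtain \<eta> where \<eta>: "\<eta> > 0" "\<And>p. p \<in> X \<Longrightarrow> dist p x < \<eta> \<Longrightarrow> dist (u x) (u p) < \<delta>"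
    using u_cont[OF xy(1) \<delta>(1)] by blast
  obtain \<eta>' where \<eta>': "\<eta>' > 0" "\<And>p. p \<in> X \<Longrightarrow> dist p y < \<eta>' \<Longrightarrow> dist (u y) (u p) < \<delta>"
    using u_cont[OF xy(2) \<delta>(1)] by blast
  have "(x, y) \<in> closure {p \<in> X \<times> X. minimal_point G (X \<times> X) (diag_action X \<phi>) p}"
    using dense xy by blast
  moreover have "min \<epsilon> (min \<eta> \<eta>') > 0" using e \<eta>(1) \<eta>'(1) by simp
  ultimately obtain w where w: "w \<in> {p \<in> X \<times> X. minimal_point G (X \<times> X) (diag_action X \<phi>) p}"
      "dist w (x, y) < min \<epsilon> (min \<eta> \<eta>')"
    unfolding closure_approachable by meson
  obtain a b where ab_w: "w = (a, b)" by (rule prod.exhaust)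
  have ab: "a \<in> X" "b \<in> X" "minimal_point G (X \<times> X) (diag_action X \<phi>) (a, b)"
    and close: "dist (a, b) (x, y) < min \<epsilon> (min \<eta> \<eta>')"
    using w by (simp_all add: ab_w)
  have "dist a x < min \<epsilon> (min \<eta> \<eta>')" "dist b y < min \<epsilon> (min \<eta> \<eta>')"
    using close dist_fst_le[of "(a, b)" "(x, y)"] dist_snd_le[of "(a, b)" "(x, y)"] by auto
  then have near: "dist a x < \<epsilon>" "dist b y < \<epsilon>" "dist a x < \<eta>" "dist b y < \<eta>'" by auto
  have uX: "u a \<in> X" "u b \<in> X" using ellis_maps[OF u(1)] ab by auto
  \<comment> \<open>As \<open>u x = u y\<close>, both \<open>u a\<close> and \<open>u b\<close> lie
    within \<open>\<delta>\<close> of the same point \<open>u x\<close>.\<close>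
  have "central_star_set G {g \<in> carrier G. dist (\<phi> g (u a)) (\<phi> g (u b)) < \<epsilon>}"
    using \<delta>(2)[OF uX] \<eta>(2)[OF ab(1) near(3)] \<eta>'(2)[OF ab(2) near(4)] u(3)
    by (simp add: dist_commute)
  \<comment> \<open>The roles are now reversed: \<open>(u a, u b)\<close> is moved and the minimal
    pair \<open>(a, b)\<close> is the target.\<close>
  moreover have "proximal_pair G (diag_action X \<phi>) (u a, u b) (a, b)"
    using idempotent_diag_proximal[OF u(1,2) ab(1,2)] by (simp add: proximal_pair_def dist_commute)
  ultimately have "dist a b \<le> \<epsilon>"
    using central_star_dist_le[OF uX ab(1,2,3)] by blast
  then have "dist x y < 4 * \<epsilon>" using near(1,2) e by metric
  then show False by (simp add: \<epsilon>_def)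
qed


subsection \<open>Poincare recurrence along IP-sets\<close>

context
  fixes \<mu> :: "'x measure"
  assumes \<mu>: "invariant_prob G X \<phi> \<mu>"
begin

text \<open>Recurrence is run with compact sets: they are Borel, and so are their images under the
  action.\<close>

lemma compact_measurable: "compact A \<Longrightarrow> A \<subseteq> X \<Longrightarrow> A \<in> sets \<mu>"
  using \<mu> borel_compact[of A] by (auto simp: invariant_prob_def sets_restrict_space Int_absorb1)

lemma compact_act_image: "g \<in> carrier G \<Longrightarrow> compact A \<Longrightarrow> A \<subseteq> X \<Longrightarrow> compact (\<phi> g ` A)"
  by (rule compact_continuous_image[OF continuous_on_subset[OF continuous]])

lemma act_image_subset: "g \<in> carrier G \<Longrightarrow> A \<subseteq> X \<Longrightarrow> \<phi> g ` A \<subseteq> X"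
  using act_closed by blast

lemma measure_act_image:
  "g \<in> carrier G \<Longrightarrow> compact A \<Longrightarrow> A \<subseteq> X \<Longrightarrow> measure \<mu> (\<phi> g ` A) = measure \<mu> A"
  using \<mu> compact_measurable by (simp add: invariant_prob_def measure_def)

lemma compact_return:
  assumes "g \<in> carrier G" "compact A" "A \<subseteq> X"
  shows "compact {a \<in> A. \<phi> g a \<in> A}"
proof -
  have "closed (A \<inter> \<phi> g -` A)"
    by (intro continuous_closed_preimage continuous_on_subset[OF continuous] compact_imp_closed assms)
  then have "compact (A \<inter> (A \<inter> \<phi> g -` A))" by (rule compact_Int_closed[OF assms(2)])
  moreover have "A \<inter> (A \<inter> \<phi> g -` A) = {a \<in> A. \<phi> g a \<in> A}" by blast
  ultimately show ?thesis by simp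
qed

text \<open>Otherwise the images of \<open>A\<close> under the products \<open>p n \<otimes> \<dots> \<otimes> p (n + k)\<close> would be
  infinitely many almost disjoint sets of equal positive measure.\<close>

lemma IP_recurrence:
  assumes p: "range p \<subseteq> carrier G" and A: "compact A" "A \<subseteq> X" and pos: "measure \<mu> A > 0"
  shows "\<exists>g\<in>FP_from G p n. measure \<mu> {a \<in> A. \<phi> g a \<in> A} > 0"
proof (rule ccontr)
  assume none: "\<not> ?thesis"
  interpret M: prob_space \<mu> using \<mu> by (simp add: invariant_prob_def)
  define h where "h = rec_nat \<one> (\<lambda>k a. a \<otimes> p (n + k))"
  have hG: "h k \<in> carrier G" for k
    by (induction k) (use range_subsetD[OF p] in \<open>auto simp: h_def\<close>)
  define B where "B i = \<phi> (h i) ` A" for i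
  have B: "B i \<in> sets \<mu>" "measure \<mu> (B i) = measure \<mu> A" for i
    using compact_measurable compact_act_image act_image_subset measure_act_image hG A
    by (auto simp: B_def)
  \<comment> \<open>If \<open>z\<close> is the image of \<open>a\<close> under \<open>h i\<close>
    and of \<open>b\<close> under \<open>h j = h i \<otimes> g\<close>, cancelling
    \<open>h i\<close> gives \<open>a = \<phi> g b\<close>. So \<open>b\<close> lies in the null set
    \<open>R\<close> of points of \<open>A\<close> that \<open>g\<close> returns to
    \<open>A\<close>, and the two images meet inside a translate of \<open>R\<close>.\<close>
  have disj: "AE z in \<mu>. z \<notin> B i \<or> z \<notin> B j" if ij: "i < j" for i j
  proof -
    obtain d where d: "j = i + Suc d" using less_imp_Suc_add[OF ij] by auto
    obtain g where g: "g \<in> FP_from G p (n + i)" "h j = h i \<otimes> g"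
      using FP_from_partial_products[OF p, of n i d] unfolding h_def d by blast
    have gG: "g \<in> carrier G" by (rule FP_from_closed[OF p g(1)])
    define R where "R = {a \<in> A. \<phi> g a \<in> A}"
    have R: "compact R" "R \<subseteq> X" using compact_return[OF gG A] A(2) by (auto simp: R_def)
    have hg: "h i \<otimes> g \<in> carrier G" using hG gG by blast
    have "measure \<mu> R = 0"
    proof -
      have "g \<in> FP_from G p n" by (rule FP_from_antimono[OF g(1)]) simp
      then have "\<not> measure \<mu> R > 0" using none by (auto simp: R_def)
      then show ?thesis using measure_nonneg[of \<mu> R] by linarith
    qed
    have eq: "B i \<inter> B j \<subseteq> \<phi> (h i \<otimes> g) ` R"
    proof
      fix z assume "z \<in> B i \<inter> B j"
      then obtain a b where ab: "a \<in> A" "z = \<phi> (h i) a" "b \<in> A" "z = \<phi> (h i \<otimes> g) b"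
        by (auto simp: B_def g(2))
      have "z = \<phi> (h i) (\<phi> g b)" using ab A(2) gG hG composition_rule by auto
      then have "a = \<phi> g b"
        using inj_onD[OF inj_prop[OF hG[of i]], of a "\<phi> g b"] ab A(2) act_closed[OF gG] by auto
      then have "b \<in> R" using ab by (simp add: R_def)
      then show "z \<in> \<phi> (h i \<otimes> g) ` R" unfolding ab(4) by (rule imageI)
    qed
    have "measure \<mu> (\<phi> (h i \<otimes> g) ` R) = 0"
      using measure_act_image[OF hg R] \<open>measure \<mu> R = 0\<close> by simp
    then have "\<phi> (h i \<otimes> g) ` R \<in> null_sets \<mu>"
      using compact_measurable[OF compact_act_image[OF hg R] act_image_subset[OF hg R(2)]]
      by (simp add: null_sets_def M.emeasure_eq_measure)
    then have "AE z in \<mu>. z \<notin> \<phi> (h i \<otimes> g) ` R" by (rule AE_not_in)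
    then show ?thesis by eventually_elim (use eq in blast)
  qed
  have sum: "real N * measure \<mu> A \<le> 1" for N
  proof -
    have "pairwise (\<lambda>i j. AE z in \<mu>. z \<notin> B i \<or> z \<notin> B j) {..<N}"
      unfolding pairwise_def
    proof (intro ballI impI)
      fix i j :: nat assume "i \<noteq> j"
      then consider "i < j" | "j < i" by linarith
      then show "AE z in \<mu>. z \<notin> B i \<or> z \<notin> B j"
      proof cases
        case 2
        show ?thesis using disj[OF 2] by eventually_elim blast
      qed (rule disj)
    qed
    then have "measure \<mu> (\<Union>i<N. B i) = (\<Sum>i<N. measure \<mu> (B i))"
      by (intro measure_UNION_AE) (use B M.fmeasurable_eq_sets in auto)
    then show ?thesis using B(2) M.prob_le_1[of "\<Union>i<N. B i"] by simp
  qed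
  obtain N :: nat where "1 < real N * measure \<mu> A" using reals_Archimedean3[OF pos] by blast
  then show False using sum[of N] by linarith
qed

text \<open>Recurrence is iterated: within the current compact set of positive measure, keep the
  points that some \<open>g k\<close> returns to it, with \<open>g k\<close> taken from a tail
  beyond the earlier choices. A point common to all these sets stays in \<open>A\<close> along every
  finite product of the \<open>g k\<close>.\<close>

lemma IP_recurrent_point:
  assumes p: "range p \<subseteq> carrier G" and A: "compact A" "A \<subseteq> X" and pos: "measure \<mu> A > 0"
  obtains g a where "range g \<subseteq> carrier G" "FP_from G g 0 \<subseteq> FP_from G p 0" "a \<in> A"
    "\<And>h. h \<in> FP_from G g 0 \<Longrightarrow> \<phi> h a \<in> A"
proof -
  define P where "P s \<longleftrightarrow> compact (fst s) \<and> fst s \<subseteq> A \<and> measure \<mu> (fst s) > 0" for s :: "'x set \<times> nat"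
  define Q where "Q s t g \<longleftrightarrow> g \<in> FP_from G p (snd s) \<and> snd s \<le> snd t \<and>
      (\<forall>h\<in>FP_from G p (snd t). g \<otimes> h \<in> FP_from G p (snd s)) \<and>
      fst t \<subseteq> fst s \<and> \<phi> g ` fst t \<subseteq> fst s" for s t :: "'x set \<times> nat" and g
  have "\<exists>t. P t \<and> (\<exists>g. Q s t g)" if s: "P s" for s
  proof -
    have sX: "compact (fst s)" "fst s \<subseteq> X" "measure \<mu> (fst s) > 0" using s A(2) by (auto simp: P_def)
    obtain g where g: "g \<in> FP_from G p (snd s)" "measure \<mu> {a \<in> fst s. \<phi> g a \<in> fst s} > 0"
      using IP_recurrence[OF p sX] by blast
    obtain m where m: "m \<ge> snd s" "\<forall>h\<in>FP_from G p m. g \<otimes> h \<in> FP_from G p (snd s)"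
      using FP_from_mult[OF p g(1)] by blast
    have "P ({a \<in> fst s. \<phi> g a \<in> fst s}, m)"
      using g compact_return[OF FP_from_closed[OF p g(1)] sX(1,2)] s by (auto simp: P_def)
    moreover have "Q s ({a \<in> fst s. \<phi> g a \<in> fst s}, m) g"
      using g(1) m by (auto simp: Q_def)
    ultimately show ?thesis by blast
  qed
  moreover have "P (A, 0)" using A pos by (simp add: P_def)
  ultimately have "\<exists>S. \<forall>n. P (S n) \<and> (\<exists>g. Q (S n) (S (Suc n)) g)"
    by (intro dependent_nat_choice) blast+
  then obtain S g where P: "\<And>n. P (S n)" and Q: "\<And>n. Q (S n) (S (Suc n)) (g n)" by metis
  have "g k \<in> carrier G" for k
    by (rule FP_from_closed[OF p, of _ "snd (S k)"]) (use Q[of k] in \<open>simp add: Q_def\<close>)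
  then have gG: "range g \<subseteq> carrier G" by blast
  have anti: "fst (S j) \<subseteq> fst (S i)" if "i \<le> j" for i j
    by (rule lift_Suc_antimono_le[of "\<lambda>i. fst (S i)", OF _ that]) (use Q in \<open>auto simp: Q_def\<close>)
  \<comment> \<open>Positive measure makes each set nonempty, and nested nonempty compact sets have
    a common point.\<close>
  have "A \<inter> (\<Inter>i\<in>UNIV. fst (S i)) \<noteq> {}"
  proof (rule compact_imp_fip_image[OF A(1)])
    show "closed (fst (S i))" for i using P compact_imp_closed by (auto simp: P_def)
    fix J :: "nat set" assume J: "finite J"
    define k where "k = Max (insert 0 J)"
    have "fst (S k) \<subseteq> fst (S i)" if "i \<in> J" for i
      by (rule anti) (use J that in \<open>simp add: k_def\<close>)
    moreover have "fst (S k) \<noteq> {}" "fst (S k) \<subseteq> A" using P[of k] by (auto simp: P_def)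
    ultimately show "A \<inter> (\<Inter>i\<in>J. fst (S i)) \<noteq> {}" by blast
  qed
  then obtain a where a: "a \<in> A" "\<And>i. a \<in> fst (S i)" by blast
  have "\<phi> h a \<in> fst (S 0)" if "h \<in> FP_from G g 0" for h
  proof (rule FP_from_hits[OF _ _ _ _ _ that])
    show "\<phi> (g k) a \<in> fst (S k)" for k using Q[of k] a(2)[of "Suc k"] by (auto simp: Q_def)
  qed (use gG a A Q in \<open>auto simp: Q_def\<close>)
  then have "\<phi> h a \<in> A" if "h \<in> FP_from G g 0" for h
    using that P[of 0] by (auto simp: P_def)
  moreover have "FP_from G g 0 \<subseteq> FP_from G p 0"
  proof
    fix h assume "h \<in> FP_from G g 0"
    then have "h \<in> FP_from G p (snd (S 0))"
      by (rule FP_from_blocks[where m = "\<lambda>i. snd (S i)", rotated -1]) (use Q in \<open>auto simp: Q_def\<close>)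
    then show "h \<in> FP_from G p 0" by (rule FP_from_antimono) simp
  qed
  ultimately show thesis using that gG a(1) by blast
qed

text \<open>By minimality the translates of the open ball cover \<open>X\<close>, and by compactness
  finitely many of them do. If the closed ball were null, so would be its translates and therefore
  \<open>X\<close>.\<close>

lemma minimal_cball_measure_pos:
  assumes minimal: "minimal_system G X \<phi>" and x: "x \<in> X" and r: "r > 0"
  shows "measure \<mu> (X \<inter> cball x r) > 0"
proof (rule ccontr)
  interpret M: prob_space \<mu> using \<mu> by (simp add: invariant_prob_def)
  define A where "A = X \<inter> cball x r"
  have A: "compact A" "A \<subseteq> X" using compact by (auto simp: A_def compact_Int_closed)
  assume "\<not> ?thesis"
  then have A0: "measure \<mu> A = 0"
    using measure_nonneg[of \<mu> A] unfolding A_def by linarith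
  define W where "W g = X \<inter> \<phi> g -` (X \<inter> ball x r)" for g
  have W: "openin (top_of_set X) (W g)" if "g \<in> carrier G" for g
    unfolding W_def
    by (rule continuous_openin_preimage[OF continuous[OF that], where T = X])
      (use act_closed[OF that] in \<open>auto intro: openin_open_Int\<close>)
  \<comment> \<open>The points whose orbit avoids the open ball: a closed invariant set that misses
    \<open>x\<close>.\<close>
  define K where "K = X - (\<Union>g\<in>carrier G. W g)"
  have "openin (top_of_set X) (\<Union>g\<in>carrier G. W g)" using W by (intro openin_Union) auto
  then have "closedin (top_of_set X) K"
    unfolding K_def by (rule closedin_diff[rotated]) simp
  moreover have "ginvariant G \<phi> K"
    unfolding ginvariant_def
  proof (intro ballI subsetI)
    fix g w assume g: "g \<in> carrier G" and "w \<in> \<phi> g ` K"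
    then obtain z where z: "z \<in> X" "\<And>h. h \<in> carrier G \<Longrightarrow> z \<notin> W h" "w = \<phi> g z" by (auto simp: K_def)
    have "w \<notin> W h" if h: "h \<in> carrier G" for h
      using z(2)[OF m_closed[OF h g]] z(1,3) composition_rule[OF z(1) h g] by (auto simp: W_def)
    then show "w \<in> K" using z(1,3) act_closed[OF g] by (auto simp: K_def)
  qed
  moreover have "x \<in> W \<one>" using x r by (simp add: W_def act_one)
  then have "K \<subset> X" using x by (auto simp: K_def)
  ultimately have "K = {}" using minimal unfolding minimal_system_def by blast
  then have "X \<subseteq> \<Union>(W ` carrier G)" by (auto simp: K_def)
  moreover have "\<forall>c\<in>W ` carrier G. openin (top_of_set X) c" using W by blast
  ultimately obtain D where D: "D \<subseteq> W ` carrier G" "finite D" "X \<subseteq> \<Union>D"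
    using compact unfolding compact_eq_openin_cover by meson
  obtain F where F: "F \<subseteq> carrier G" "finite F" "X \<subseteq> (\<Union>g\<in>F. W g)"
    using finite_subset_image[OF D(2,1)] D(3) by auto
  have null: "\<phi> (inv g) ` A \<in> null_sets \<mu>" if "g \<in> F" for g
  proof -
    have g: "inv g \<in> carrier G" using that F(1) by blast
    show ?thesis
      using measure_act_image[OF g A] A0
        compact_measurable[OF compact_act_image[OF g A] act_image_subset[OF g A(2)]]
      by (simp add: null_sets_def M.emeasure_eq_measure)
  qed
  have "W g \<subseteq> \<phi> (inv g) ` A" if "g \<in> F" for g
  proof
    fix z assume z: "z \<in> W g"
    have eq: "\<phi> (inv g) (\<phi> g z) = z"
      by (rule orbit_sym_aux[of g z "\<phi> g z"]) (use z that F(1) in \<open>auto simp: W_def\<close>)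
    have "\<phi> g z \<in> A" using z by (auto simp: W_def A_def)
    then have "\<phi> (inv g) (\<phi> g z) \<in> \<phi> (inv g) ` A" by (rule imageI)
    then show "z \<in> \<phi> (inv g) ` A" unfolding eq .
  qed
  then have "(\<Union>g\<in>F. W g) \<subseteq> (\<Union>g\<in>F. \<phi> (inv g) ` A)" by (rule UN_mono[OF order_refl])
  then have XF: "X \<subseteq> (\<Union>g\<in>F. \<phi> (inv g) ` A)" by (rule subset_trans[OF F(3)])
  have spc: "space \<mu> = X"
    using sets_eq_imp_space_eq[of \<mu> "restrict_space borel X"] \<mu>
    by (simp add: invariant_prob_def space_restrict_space)
  have "(\<Union>g\<in>F. \<phi> (inv g) ` A) \<in> null_sets \<mu>"
    by (rule null_sets.finite_UN[OF F(2) null])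
  then have "space \<mu> \<in> null_sets \<mu>"
    by (rule null_sets_subset) (use XF spc in auto)
  then show False using M.emeasure_space_1 by (simp add: null_sets_def)
qed

text \<open>For a proximal pair the point \<open>y\<close> is minimal, so \<open>x\<close> comes
  near \<open>y\<close> along an IP-set. Along a sub-IP-set some \<open>a\<close> near
  \<open>x\<close> stays near \<open>x\<close>, while equicontinuity at \<open>x\<close> provides a
  time \<open>h\<close> in it at which \<open>\<phi> h a\<close> is near \<open>\<phi> h x\<close>,
  hence near \<open>y\<close>.\<close>

lemma pairwise_IP_star_equicont_imp_distal:
  assumes minimal: "minimal_system G X \<phi>" and equi: "pairwise_IP_star_equicont G X \<phi>"
  shows "distal_system G X \<phi>"
proof (rule ccontr)
  assume "\<not> distal_system G X \<phi>"
  then obtain x y where xy: "x \<in> X" "y \<in> X" "x \<noteq> y" and prox: "proximal_pair G \<phi> x y"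
    unfolding distal_system_def using not_distal_pair_iff by blast
  have "minimal_point G X \<phi> y"
    unfolding minimal_point_def
    using minimal xy(2) act_closed by (intro exI[of _ X]) (auto simp: ginvariant_def)
  define \<epsilon> where "\<epsilon> = dist x y / 4"
  have e: "\<epsilon> > 0" using xy by (simp add: \<epsilon>_def)
  have "IP_set G (hitting G \<phi> x (X \<inter> ball y \<epsilon>))"
    by (rule proximal_minimal_hitting_IP_set) (fact | rule nbhd_ball)+
  then obtain p where p: "range p \<subseteq> carrier G" "FP_from G p 0 \<subseteq> hitting G \<phi> x (X \<inter> ball y \<epsilon>)"
    by (rule IP_setE)
  have point: "pairwise_equicont_point (IP_star_set G) G X \<phi> x"
    using equi xy(1) by (simp add: pairwise_IP_star_equicont_def)
  obtain \<delta> where \<delta>: "\<delta> > 0" "\<And>p q. p \<in> X \<Longrightarrow> q \<in> X \<Longrightarrow> dist p x < \<delta> \<Longrightarrow> dist q x < \<delta> \<Longrightarrow>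
      IP_star_set G {g \<in> carrier G. dist (\<phi> g p) (\<phi> g q) < \<epsilon>}"
    by (rule pairwise_equicont_pointD[OF point e]) (rule that)
  \<comment> \<open>Halving \<open>\<delta>\<close> puts the closed ball, needed for compactness,
    inside the open ball of equicontinuity; the bound \<open>\<epsilon>\<close> serves the final
    estimate.\<close>
  define r where "r = min \<epsilon> (\<delta>/2)"
  have r: "r > 0" "r \<le> \<epsilon>" "r < \<delta>" using e \<delta>(1) by (auto simp: r_def)
  obtain g a where g: "range g \<subseteq> carrier G" "FP_from G g 0 \<subseteq> FP_from G p 0"
    and a: "a \<in> X \<inter> cball x r" "\<And>h. h \<in> FP_from G g 0 \<Longrightarrow> \<phi> h a \<in> X \<inter> cball x r"
    by (rule IP_recurrent_point[OF p(1) _ _ minimal_cball_measure_pos[OF minimal xy(1) r(1)]])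
      (use compact in \<open>auto simp: compact_Int_closed\<close>)
  have "IP_set G (FP_from G g 0)"
    by (rule IP_setI[OF g(1) order_refl]) (use FP_from_closed[OF g(1)] in blast)
  moreover have "IP_star_set G {h \<in> carrier G. dist (\<phi> h a) (\<phi> h x) < \<epsilon>}"
    by (rule \<delta>(2)) (use a(1) xy(1) \<delta>(1) r in \<open>auto simp: dist_commute\<close>)
  ultimately obtain h where h: "h \<in> FP_from G g 0" "dist (\<phi> h a) (\<phi> h x) < \<epsilon>"
    unfolding IP_star_set_def by blast
  have "dist y (\<phi> h x) < \<epsilon>" using h(1) g(2) p(2) by (auto simp: hitting_def)
  moreover have "dist x (\<phi> h a) \<le> \<epsilon>" using a(2)[OF h(1)] r(2) by auto
  ultimately have "dist x y < 4 * \<epsilon>" using h(2) e by metric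
  then show False by (simp add: \<epsilon>_def)
qed

end

end

theorem theorem1p1:
  fixes G :: "('g, 'm) monoid_scheme" and X :: "'x::metric_space set"
    and \<phi> :: "'g \<Rightarrow> 'x \<Rightarrow> 'x"
  assumes system: "dyn_system G X \<phi>"
    and minimal: "minimal_system G X \<phi>"
  shows "((\<exists>\<mu>. invariant_prob G X \<phi> \<mu>) \<longrightarrow>
            (distal_system G X \<phi> \<longleftrightarrow> pairwise_IP_star_equicont G X \<phi>)) \<and>
         (X \<times> X \<subseteq> closure {p \<in> X \<times> X. minimal_point G (X \<times> X) (diag_action X \<phi>) p} \<longrightarrow>
            (distal_system G X \<phi> \<longleftrightarrow> pairwise_IP_star_equicont G X \<phi>) \<and>
            (pairwise_IP_star_equicont G X \<phi> \<longleftrightarrow> pairwise_central_star_equicont G X \<phi>))"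
proof -
  interpret dyn_system G X \<phi> by fact
  show ?thesis
    using distal_imp_pairwise_IP_star_equicont pairwise_IP_star_equicont_imp_distal[OF _ minimal]
      pairwise_IP_star_imp_central_star_equicont[of G X \<phi>] pairwise_central_star_equicont_imp_distal
    by blast
qed

end
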